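(* Let $(\eta,\overline{\boldsymbol u})$ be a sufficiently regular spatially periodic solution on the periodic cell $S_H$ of any one of the three location-uncertainty (LU) wave models (LU Saint-Venant, LU Boussinesq, LU Serre-Green-Naghdi) defined in the context, and assume that the depth-averaged horizontal noise vanishes on $\partial S_H$. Let $\rho_0>0$ be the constant density. Then, pathwise, the total momentum is conserved: $$\mathrm d_t\,\boldsymbol p=0,\qquad\text{where }\ \boldsymbol p=\rho_0\int_{S_H}h\,\overline{\boldsymbol u}\,\mathrm dS_H,\ h=1+\epsilon\eta .$$
   Context: Let $d\in\{1,2\}$ and let $S_H\subset\mathbb R^d$ be a bounded interval ($d=1$) or rectangle ($d=2$), regarded as a periodic cell: all fields below and their spatial derivatives satisfy periodic boundary conditions on $\partial S_H$. $\nabla_H$ and $\nabla_H\cdot$ are the gradient and divergence in the horizontal variables. The parameters $\epsilon,\beta,\Upsilon>0$ are constants. All quantities are nondimensional. Work on a filtered probability space carrying independent standard one-dimensional Brownian motions $(\beta^n)_n$. The unknowns are the surface elevation $\eta(\boldsymbol x,t)\in\mathbb R$ and the depth-averaged horizontal velocity $\overline{\boldsymbol u}(\boldsymbol x,t)\in\mathbb R^d$; the water depth is $h=1+\epsilon\eta$, assumed positive. The depth-averaged Itô-Stokes drift $\overline{\boldsymbol u}_s(\boldsymbol x,t)\in\mathbb R^d$ is a periodic field. The depth-averaged horizontal noise is $\overline{\boldsymbol\sigma\circ\mathrm d\boldsymbol B_t^H}=\sum_n\boldsymbol\varphi_n(\boldsymbol x,t)\circ\mathrm d\beta^n_t$ with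 $\mathbb R^d$-valued spatially periodic fields $\boldsymbol\varphi_n$ (Stratonovich sense). "The noise vanishes on $\partial S_H$" means that every $\boldsymbol\varphi_n$ vanishes there. Set $\overline{\boldsymbol u}^*=\overline{\boldsymbol u}-\tfrac12\Upsilon\epsilon\,\overline{\boldsymbol u}_s$. All stochastic differentials and products of processes with stochastic differentials are in the Stratonovich sense, $\mathrm d_t$ denotes the time differential at fixed $\boldsymbol x$ (or of a space-independent process), and for a scalar or vector field $f$ $$\overline D^H_t f=\mathrm d_t f+\epsilon(\overline{\boldsymbol u}^*\cdot\nabla_H)f\,\mathrm dt+\Upsilon^{1/2}\epsilon\,(\overline{\boldsymbol\sigma\circ\mathrm d\boldsymbol B_t^H}\cdot\nabla_H)f .$$ The three models are the systems $$\overline D^H_t\eta=-h\big(\nabla_H\cdot\overline{\boldsymbol u}^*\,\mathrm dt+\Upsilon^{1/2}\nabla_H\cdot\overline{\boldsymbol\sigma\circ\mathrm d\boldsymbol B_t^H}\big),$$ $$\overline D^H_t\overline{\boldsymbol u}+\nabla_H\eta\,\mathrm dt-\frac1h\,\epsilon\beta^2\,\nabla_H\Big(\frac{h^3}{3}\,\mathrm d\overline G\Big)=0,$$ with, respectively: - LU Saint-Venant: $\mathrm d\overline G=0$; - LU Boussinesq: $\mathrm d\overline G=\mathrm d_t(\nabla_H\cdot\overline{\boldsymbol u})$; - LU Serre-Green-Naghdi: $\mathrm d\overline G=\overline D^H_t(\nabla_H\cdot\overline{\boldsymbol u})-\epsilon\,\nabla_H\cdot\big(\overline{\boldsymbol u}^*\,\mathrm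 dt+\Upsilon^{1/2}\overline{\boldsymbol\sigma\circ\mathrm d\boldsymbol B_t^H}\big)\,\nabla_H\cdot\overline{\boldsymbol u}$. "Sufficiently regular" means: $\eta,\overline{\boldsymbol u}$ are continuous semimartingales in time with values in spatially smooth periodic fields, the coefficients $\overline{\boldsymbol u}_s,\boldsymbol\varphi_n$ are smooth in space and are such that all sums and Stratonovich integrals converge, and the Stratonovich product rule, spatial differentiation and integration over $S_H$ may be applied to and interchanged with the stochastic differentials. *)

theory Defs
  imports "HOL-Probability.Probability"
begin

text \<open>
  Random fields \<open>X t x w\<close> depend on time, on the horizontal position in \<open>real ^ 'd\<close> and on the
  sample point.  Periodic fields on the cell are represented by their periodic extensions to the
  whole space.
\<close>

type_synonym 'w process = "real \<Rightarrow> 'w \<Rightarrow> real"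
type_synonym ('d, 'w) field = "real \<Rightarrow> real ^ 'd \<Rightarrow> 'w \<Rightarrow> real"
type_synonym ('d, 'w) vfield = "real \<Rightarrow> real ^ 'd \<Rightarrow> 'w \<Rightarrow> real ^ 'd"

definition component :: "('d, 'w) vfield \<Rightarrow> 'd \<Rightarrow> ('d::finite, 'w) field" where
  "component v i = (\<lambda>t x w. v t x w $ i)"

definition pd :: "'d \<Rightarrow> ('d::finite, 'w) field \<Rightarrow> ('d, 'w) field" where
  "pd i f = (\<lambda>t x w. frechet_derivative (\<lambda>y. f t y w) (at x) (axis i 1))"

definition divg :: "('d::finite, 'w) vfield \<Rightarrow> ('d, 'w) field" where
  "divg v = (\<lambda>t x w. \<Sum>i\<in>UNIV. pd i (component v i) t x w)"

text \<open>Primitive in time of the differential \<open>f dt\<close>.\<close>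

definition tint :: "('d::finite, 'w) field \<Rightarrow> ('d, 'w) field" where
  "tint f = (\<lambda>t x w. LINT s:{0..t}|lborel. f s x w)"

definition is_partition :: "real \<Rightarrow> (nat \<Rightarrow> real) \<Rightarrow> nat \<Rightarrow> bool" where
  "is_partition t p K \<longleftrightarrow> p 0 = 0 \<and> p K = t \<and> (\<forall>k<K. p k \<le> p (Suc k))"

definition refining_partitions :: "real \<Rightarrow> (nat \<Rightarrow> nat \<Rightarrow> real) \<Rightarrow> (nat \<Rightarrow> nat) \<Rightarrow> bool" where
  "refining_partitions t p K \<longleftrightarrow>
     (\<forall>m. is_partition t (p m) (K m)) \<and>
     (\<forall>\<delta>>0. \<forall>\<^sub>F m in sequentially. \<forall>k<K m. p m (Suc k) - p m k < \<delta>)"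

text \<open>
  The filtration is indexed by all reals, but only times in \<open>{0..T}\<close> matter; \<open>T\<close> is an arbitrary
  finite time horizon.  The periodic cell is \<open>cbox a b\<close>.
\<close>

locale stochastic_cell = prob_space M + filtration "space M" F
  for M :: "'w measure" and F :: "real \<Rightarrow> 'w measure" +
  fixes T :: real and a b :: "real ^ 'd::finite"
  assumes subalg: "\<And>t. subalgebra M (F t)"
    and horizon: "0 < T"
    and cell: "\<And>i. a $ i < b $ i"
begin

subsection \<open>Semimartingales and Brownian motions\<close>

definition adapted :: "'w process \<Rightarrow> bool" where
  "adapted X \<longleftrightarrow> (\<forall>t\<in>{0..T}. X t \<in> borel_measurable (F t))"

definition continuous_paths :: "'w process \<Rightarrow> bool" where
  "continuous_paths X \<longleftrightarrow> (\<forall>w\<in>space M. continuous_on {0..T} (\<lambda>t. X t w))"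

definition martingale :: "'w process \<Rightarrow> bool" where
  "martingale X \<longleftrightarrow> adapted X \<and> (\<forall>t\<in>{0..T}. integrable M (X t)) \<and>
     (\<forall>s\<in>{0..T}. \<forall>t\<in>{s..T}. AE w in M. real_cond_exp M (F s) (X t) w = X s w)"

definition continuous_local_martingale :: "'w process \<Rightarrow> bool" where
  "continuous_local_martingale X \<longleftrightarrow> adapted X \<and> continuous_paths X \<and>
     (\<exists>\<tau> :: nat \<Rightarrow> 'w \<Rightarrow> real.
        (\<forall>n. stopping_time F (\<tau> n)) \<and>
        (\<forall>n. \<forall>w\<in>space M. 0 \<le> \<tau> n w \<and> \<tau> n w \<le> \<tau> (Suc n) w) \<and>
        (AE w in M. \<exists>n. T \<le> \<tau> n w) \<and>
        (\<forall>n. martingale (\<lambda>t w. X (min t (\<tau> n w)) w - X 0 w)))"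

definition finite_variation :: "'w process \<Rightarrow> bool" where
  "finite_variation A \<longleftrightarrow> (\<forall>w\<in>space M. \<exists>C. \<forall>p K. is_partition T p K \<longrightarrow>
     (\<Sum>k<K. \<bar>A (p (Suc k)) w - A (p k) w\<bar>) \<le> C)"

definition continuous_semimartingale :: "'w process \<Rightarrow> bool" where
  "continuous_semimartingale X \<longleftrightarrow>
     (\<exists>L A. continuous_local_martingale L \<and>
        adapted A \<and> continuous_paths A \<and> finite_variation A \<and>
        (\<forall>t\<in>{0..T}. \<forall>w\<in>space M. X t w = L t w + A t w))"

definition brownian_motion :: "'w process \<Rightarrow> bool" where
  "brownian_motion B \<longleftrightarrow> adapted B \<and> (AE w in M. B 0 w = 0) \<and>
     (AE w in M. continuous_on {0..T} (\<lambda>t. B t w)) \<and>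
     (\<forall>s\<in>{0..T}. \<forall>t\<in>{s<..T}.
        distributed M lborel (\<lambda>w. B t w - B s w) (normal_density 0 (sqrt (t - s))) \<and>
        indep_set (sets (F s)) {(\<lambda>w. B t w - B s w) -` U \<inter> space M | U. U \<in> sets borel})"

definition independent_brownian_motions :: "(nat \<Rightarrow> 'w process) \<Rightarrow> bool" where
  "independent_brownian_motions B \<longleftrightarrow> (\<forall>n. brownian_motion (B n)) \<and>
     indep_vars (\<lambda>_. PiM {0..T} (\<lambda>_. borel)) (\<lambda>n w. \<lambda>t\<in>{0..T}. B n t w) UNIV"


subsection \<open>Stratonovich integrals\<close>

definition tendsto_in_prob :: "(nat \<Rightarrow> 'w \<Rightarrow> real) \<Rightarrow> ('w \<Rightarrow> real) \<Rightarrow> bool" where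
  "tendsto_in_prob S Z \<longleftrightarrow>
     (\<forall>m. S m \<in> borel_measurable M) \<and> Z \<in> borel_measurable M \<and>
     (\<forall>e>0. (\<lambda>m. measure M {w \<in> space M. e < \<bar>S m w - Z w\<bar>}) \<longlonglongrightarrow> 0)"

text \<open>\<open>Z t\<close> is the integral of \<open>X\<close> against \<open>\<circ>dY\<close> over \<open>{0..t}\<close>.\<close>

definition stratonovich :: "'w process \<Rightarrow> 'w process \<Rightarrow> 'w process \<Rightarrow> bool" where
  "stratonovich X Y Z \<longleftrightarrow>
     (\<forall>t\<in>{0..T}. \<forall>p K. refining_partitions t p K \<longrightarrow>
        tendsto_in_prob
          (\<lambda>m w. \<Sum>k<K m. (X (p m k) w + X (p m (Suc k)) w) / 2 * (Y (p m (Suc k)) w - Y (p m k) w))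
          (Z t))"


subsection \<open>Smooth periodic random fields\<close>

definition periodic_field :: "('d, 'w) field \<Rightarrow> bool" where
  "periodic_field X \<longleftrightarrow> (\<forall>t\<in>{0..T}. \<forall>w\<in>space M. \<forall>x i.
     X t (x + (b $ i - a $ i) *\<^sub>R axis i 1) w = X t x w)"

definition spatially_smooth :: "('d, 'w) field \<Rightarrow> bool" where
  "spatially_smooth X \<longleftrightarrow> (\<forall>is. \<forall>t\<in>{0..T}. \<forall>w\<in>space M. \<forall>x.
     (\<lambda>y. foldr pd is X t y w) differentiable (at x))"

text \<open>Coefficients need not be semimartingales, nor continuous, in time.\<close>

definition coefficient_field :: "('d, 'w) field \<Rightarrow> bool" where
  "coefficient_field X \<longleftrightarrow>
     spatially_smooth X \<and> periodic_field X \<and> (\<forall>x. adapted (\<lambda>t. X t x))"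

text \<open>
  Continuous semimartingales with values in the smooth periodic functions: joint continuity of all
  spatial derivatives says that the paths are continuous for the topology of smooth functions.
\<close>

definition semimartingale_field :: "('d, 'w) field \<Rightarrow> bool" where
  "semimartingale_field X \<longleftrightarrow> spatially_smooth X \<and> periodic_field X \<and>
     (\<forall>is. (\<forall>x. continuous_semimartingale (\<lambda>t. foldr pd is X t x)) \<and>
           (\<forall>w\<in>space M. continuous_on ({0..T} \<times> UNIV) (\<lambda>(t, x). foldr pd is X t x w)))"

text \<open>
  \<open>sint X Y\<close> is the spatially smooth version of the field of integrals of \<open>X\<close> against \<open>\<circ>dY\<close> at fixed
  position; it is unique up to indistinguishability.
\<close>

definition strat_field :: "('d, 'w) field \<Rightarrow> ('d, 'w) field \<Rightarrow> ('d, 'w) field \<Rightarrow> bool" where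
  "strat_field X Y Z \<longleftrightarrow> semimartingale_field Z \<and>
     (\<forall>x. stratonovich (\<lambda>t. X t x) (\<lambda>t. Y t x) (\<lambda>t. Z t x))"

definition sint :: "('d, 'w) field \<Rightarrow> ('d, 'w) field \<Rightarrow> ('d, 'w) field" where
  "sint X Y = (SOME Z. strat_field X Y Z)"

text \<open>
  A stochastic differential is represented by any field having it as differential, so equality of
  differentials is indistinguishability, at each position, of the increments from time \<open>0\<close>.
  The product \<open>X \<circ> dY\<close> is represented by \<open>sint X Y\<close>.
\<close>

definition deq :: "('d, 'w) field \<Rightarrow> ('d, 'w) field \<Rightarrow> bool"  (infix "\<doteq>" 50) where
  "f \<doteq> g \<longleftrightarrow> (\<forall>x. AE w in M. \<forall>t\<in>{0..T}. f t x w - f 0 x w = g t x w - g 0 x w)"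

text \<open>
  Sufficient regularity.  \<open>\<A>\<close> is a class of smooth periodic semimartingale fields on which
  Stratonovich calculus is available: the integrals exist, products with differentials compose, and
  spatial derivatives may be taken inside.  \<open>\<B>\<close> is a class of coefficients of \<open>dt\<close>.
  The rule \<open>d(XY) = X \<circ> dY + Y \<circ> dX\<close> is not listed, since it holds already for the
  approximating sums; neither is the interchange of \<open>d\<close> with integration over the cell, which at
  the level of increments is linearity of the integral.
\<close>

definition stratonovich_calculus :: "('d, 'w) field set \<Rightarrow> ('d, 'w) field set \<Rightarrow> bool" where
  "stratonovich_calculus \<A> \<B> \<longleftrightarrow>
     (\<forall>X\<in>\<A>. semimartingale_field X) \<and>
     (\<forall>c. (\<lambda>t x w. c) \<in> \<A>) \<and>
     (\<forall>X\<in>\<A>. \<forall>Y\<in>\<A>. (\<lambda>t x w. X t x w + Y t x w) \<in> \<A> \<and> (\<lambda>t x w. X t x w * Y t x w) \<in> \<A>) \<and>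
     (\<forall>X\<in>\<A>. (\<forall>t\<in>{0..T}. \<forall>x. \<forall>w\<in>space M. 0 < X t x w) \<longrightarrow> (\<lambda>t x w. 1 / X t x w) \<in> \<A>) \<and>
     (\<forall>X\<in>\<A>. \<forall>i. pd i X \<in> \<A>) \<and>
     (\<forall>X\<in>\<A>. \<forall>Y\<in>\<A>. strat_field X Y (sint X Y) \<and> sint X Y \<in> \<A>) \<and>
     (\<forall>X\<in>\<A>. \<forall>Y\<in>\<A>. \<forall>Z\<in>\<A>. sint X (sint Y Z) \<doteq> sint (\<lambda>t x w. X t x w * Y t x w) Z) \<and>
     (\<forall>X\<in>\<A>. \<forall>Y\<in>\<A>. \<forall>i.
        pd i (sint X Y) \<doteq> (\<lambda>t x w. sint (pd i X) Y t x w + sint X (pd i Y) t x w)) \<and>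
     \<A> \<subseteq> \<B> \<and>
     (\<forall>f\<in>\<B>. coefficient_field f \<and> (\<forall>x. \<forall>w\<in>space M. set_integrable lborel {0..T} (\<lambda>t. f t x w))) \<and>
     (\<forall>f\<in>\<B>. \<forall>g\<in>\<B>. (\<lambda>t x w. f t x w + g t x w) \<in> \<B>) \<and>
     (\<forall>X\<in>\<A>. \<forall>f\<in>\<B>. (\<lambda>t x w. X t x w * f t x w) \<in> \<B>) \<and>
     (\<forall>f\<in>\<B>. tint f \<in> \<A>) \<and>
     (\<forall>f\<in>\<B>. \<forall>i. pd i f \<in> \<B> \<and> pd i (tint f) \<doteq> tint (pd i f))"


subsection \<open>The wave models\<close>

text \<open>
  \<open>W\<close> is a primitive in time of the depth-averaged noise:
  \<open>W t x\<close> is the sum over \<open>n\<close> of the integrals of \<open>\<phi> n\<close> against \<open>\<circ>dB n\<close> over \<open>{0..t}\<close>.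
\<close>

definition noise_primitive ::
    "(nat \<Rightarrow> ('d, 'w) vfield) \<Rightarrow> (nat \<Rightarrow> 'w process) \<Rightarrow> ('d, 'w) vfield \<Rightarrow> bool" where
  "noise_primitive \<phi> B W \<longleftrightarrow>
     (\<exists>I :: nat \<Rightarrow> 'd \<Rightarrow> ('d, 'w) field.
        (\<forall>n i x. stratonovich (\<lambda>t. component (\<phi> n) i t x) (B n) (\<lambda>t. I n i t x)) \<and>
        (\<forall>i x. \<forall>t\<in>{0..T}. tendsto_in_prob (\<lambda>N w. \<Sum>n<N. I n i t x w) (component W i t x)))"

definition vanishes_on_boundary :: "(nat \<Rightarrow> ('d, 'w) vfield) \<Rightarrow> bool" where
  "vanishes_on_boundary \<phi> \<longleftrightarrow>
     (\<forall>n. \<forall>t\<in>{0..T}. \<forall>x\<in>frontier (cbox a b). \<forall>w\<in>space M. \<phi> n t x w = 0)"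

end

definition depth :: "real \<Rightarrow> ('d::finite, 'w) field \<Rightarrow> ('d, 'w) field" where
  "depth \<epsilon> \<eta> = (\<lambda>t x w. 1 + \<epsilon> * \<eta> t x w)"

definition ustar :: "real \<Rightarrow> real \<Rightarrow> ('d::finite, 'w) vfield \<Rightarrow> ('d, 'w) vfield \<Rightarrow> ('d, 'w) vfield" where
  "ustar \<epsilon> \<Upsilon> u us = (\<lambda>t x w. u t x w - (1 / 2 * \<Upsilon> * \<epsilon>) *\<^sub>R us t x w)"

datatype wave_model = Saint_Venant | Boussinesq | Serre_Green_Naghdi

context stochastic_cell
begin

text \<open>The differential \<open>D f\<close> along the displacement \<open>v dt\<close> and the noise \<open>dW\<close>.\<close>

definition transport ::
    "real \<Rightarrow> real \<Rightarrow> ('d, 'w) vfield \<Rightarrow> ('d, 'w) vfield \<Rightarrow> ('d, 'w) field \<Rightarrow> ('d, 'w) field" where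
  "transport \<epsilon> \<Upsilon> v W f = (\<lambda>t x w.
     f t x w + \<epsilon> * tint (\<lambda>t x w. \<Sum>i\<in>UNIV. component v i t x w * pd i f t x w) t x w
     + sqrt \<Upsilon> * \<epsilon> * (\<Sum>i\<in>UNIV. sint (pd i f) (component W i) t x w))"

text \<open>\<open>g (\<nabla>\<cdot>v dt + \<Upsilon>\<^sup>1\<^sup>/\<^sup>2 \<nabla>\<cdot>dW)\<close>\<close>

definition dilation ::
    "real \<Rightarrow> ('d, 'w) vfield \<Rightarrow> ('d, 'w) vfield \<Rightarrow> ('d, 'w) field \<Rightarrow> ('d, 'w) field" where
  "dilation \<Upsilon> v W g = (\<lambda>t x w.
     tint (\<lambda>t x w. g t x w * divg v t x w) t x w + sqrt \<Upsilon> * sint g (divg W) t x w)"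

fun dG :: "wave_model \<Rightarrow> real \<Rightarrow> real \<Rightarrow> ('d, 'w) vfield \<Rightarrow> ('d, 'w) vfield \<Rightarrow> ('d, 'w) vfield
    \<Rightarrow> ('d, 'w) field" where
  "dG Saint_Venant \<epsilon> \<Upsilon> us W u = (\<lambda>t x w. 0)"
| "dG Boussinesq \<epsilon> \<Upsilon> us W u = divg u"
| "dG Serre_Green_Naghdi \<epsilon> \<Upsilon> us W u = (\<lambda>t x w.
     transport \<epsilon> \<Upsilon> (ustar \<epsilon> \<Upsilon> u us) W (divg u) t x w
     - \<epsilon> * dilation \<Upsilon> (ustar \<epsilon> \<Upsilon> u us) W (divg u) t x w)"

definition lu_solution :: "wave_model \<Rightarrow> real \<Rightarrow> real \<Rightarrow> real \<Rightarrow> ('d, 'w) vfield \<Rightarrow> ('d, 'w) vfield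
    \<Rightarrow> ('d, 'w) field \<Rightarrow> ('d, 'w) vfield \<Rightarrow> bool" where
  "lu_solution model \<epsilon> \<beta> \<Upsilon> us W \<eta> u \<longleftrightarrow>
     transport \<epsilon> \<Upsilon> (ustar \<epsilon> \<Upsilon> u us) W \<eta> \<doteq>
       (\<lambda>t x w. - dilation \<Upsilon> (ustar \<epsilon> \<Upsilon> u us) W (depth \<epsilon> \<eta>) t x w) \<and>
     (\<forall>j. (\<lambda>t x w.
         transport \<epsilon> \<Upsilon> (ustar \<epsilon> \<Upsilon> u us) W (component u j) t x w
         + tint (pd j \<eta>) t x w
         - \<epsilon> * \<beta>\<^sup>2 * sint (\<lambda>t x w. 1 / depth \<epsilon> \<eta> t x w)
             (pd j (sint (\<lambda>t x w. (depth \<epsilon> \<eta> t x w) ^ 3 / 3) (dG model \<epsilon> \<Upsilon> us W u))) t x w)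
       \<doteq> (\<lambda>t x w. 0))"

definition momentum ::
    "real \<Rightarrow> real \<Rightarrow> ('d, 'w) field \<Rightarrow> ('d, 'w) vfield \<Rightarrow> real \<Rightarrow> 'w \<Rightarrow> real ^ 'd" where
  "momentum \<rho>\<^sub>0 \<epsilon> \<eta> u t w =
     \<rho>\<^sub>0 *\<^sub>R (LINT x:cbox a b|lborel. depth \<epsilon> \<eta> t x w *\<^sub>R u t x w)"

end

end

theory Submission
  imports Defs
begin

text \<open>
  Both model equations can be put in conservation form.  Let \<open>v\<close> be the drift-corrected velocity and
  let \<open>Y\<close> be the displacement with differential \<open>dY = v dt + \<Upsilon>\<^sup>1\<^sup>/\<^sup>2 dW\<close>.  The mass equation then says
  \<open>dh + \<epsilon> \<Sum>\<^sub>i \<partial>\<^sub>i (h \<circ> dY\<^sub>i) = 0\<close>.  For a velocity component \<open>u\<^sub>j\<close>, the Stratonovich product rule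
  \<open>d(h u\<^sub>j) = h \<circ> du\<^sub>j + u\<^sub>j \<circ> dh\<close>, the momentum equation multiplied by \<open>h\<close> and the mass equation
  multiplied by \<open>u\<^sub>j\<close> give
  \<open>d(h u\<^sub>j) = - \<epsilon> \<Sum>\<^sub>i \<partial>\<^sub>i (h u\<^sub>j \<circ> dY\<^sub>i) - \<partial>\<^sub>j (\<eta> + \<epsilon>/2 \<eta>\<^sup>2) dt + \<epsilon> \<beta>\<^sup>2 \<partial>\<^sub>j (h\<^sup>3/3 \<circ> dG)\<close>.
  The dispersive term is a gradient whatever \<open>dG\<close> is, since its prefactor \<open>1/h\<close> cancels; this is why
  the three models need no separate treatment beyond \<open>dG\<close> being a regular field
  (\<open>momentum_conservation_form\<close>, \<open>\<A>_dG\<close>).  Every term on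
  the right is a spatial derivative of a smooth periodic field, so its integral over the cell vanishes
  (\<open>integral_partial_derivative_periodic\<close>), and the total momentum is constant.

  The calculus is carried out with the relation \<open>sprod X Y Z\<close>, meaning \<open>dZ = X \<circ> dY\<close>, which is linear in
  \<open>Y\<close> and \<open>Z\<close> and determines \<open>dZ\<close> (\<open>sprod_unique\<close>).  The product rule (\<open>sprod_leibniz\<close>) and the rule
  \<open>X \<circ> (f dt) = (X f) dt\<close> (\<open>sprod_tint\<close>) are proved from the approximating sums.  Identities between
  differentials hold at each position outside a null set; joint continuity of the fields gives one
  null set for all positions (\<open>deq_all_positions\<close>), so that they may be integrated over the cell.
\<close>

section \<open>Derivatives of periodic functions\<close>

lemma integral_split_cart:
  fixes g :: "real ^ 'd::finite \<Rightarrow> real"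
  assumes g: "continuous_on UNIV g" and c: "a $ i \<le> c" "c \<le> b $ i"
  shows "integral (cbox a b) g =
    integral (cbox a (b + (c - b $ i) *\<^sub>R axis i 1)) g + integral (cbox (a + (c - a $ i) *\<^sub>R axis i 1) b) g"
proof -
  let ?e = "axis i 1 :: real ^ 'd"
  have b': "(b + (c - b $ i) *\<^sub>R ?e) $ j = (if j = i then c else b $ j)"
    and a': "(a + (c - a $ i) *\<^sub>R ?e) $ j = (if j = i then c else a $ j)" for j
    by (simp_all add: axis_def)
  have le: "cbox a b \<inter> {x. x \<bullet> ?e \<le> c} = cbox a (b + (c - b $ i) *\<^sub>R ?e)"
  proof (intro set_eqI iffI)
    fix x assume "x \<in> cbox a (b + (c - b $ i) *\<^sub>R ?e)"
    then have x: "a $ j \<le> x $ j" "x $ j \<le> (if j = i then c else b $ j)" for j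
      unfolding mem_box_cart b' by blast+
    moreover have "x $ j \<le> b $ j" for j
      using x(2)[of j] c by (cases "j = i") auto
    ultimately show "x \<in> cbox a b \<inter> {x. x \<bullet> ?e \<le> c}"
      using x(2)[of i] by (simp add: mem_box_cart inner_axis)
  qed (simp add: mem_box_cart inner_axis b' del: vector_add_component)
  have ge: "cbox a b \<inter> {x. x \<bullet> ?e \<ge> c} = cbox (a + (c - a $ i) *\<^sub>R ?e) b"
  proof (intro set_eqI iffI)
    fix x assume "x \<in> cbox (a + (c - a $ i) *\<^sub>R ?e) b"
    then have x: "(if j = i then c else a $ j) \<le> x $ j" "x $ j \<le> b $ j" for j
      unfolding mem_box_cart a' by blast+
    moreover have "a $ j \<le> x $ j" for j
      using x(1)[of j] c by (cases "j = i") auto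
    ultimately show "x \<in> cbox a b \<inter> {x. x \<bullet> ?e \<ge> c}"
      using x(1)[of i] by (simp add: mem_box_cart inner_axis)
  qed (simp add: mem_box_cart inner_axis a' del: vector_add_component)
  have "g integrable_on cbox u v" for u v
    using g by (intro integrable_continuous) (auto intro: continuous_on_subset)
  then show ?thesis
    by (intro integral_unique has_integral_split[where k = ?e and c = c])
       (simp_all add: le ge axis_in_Basis_iff integrable_integral)
qed

text \<open>
  The box extended by \<open>s\<close> in direction \<open>i\<close> is cut in two ways: into the cell and a strip of width \<open>s\<close>
  beyond it, or into a strip of the same width and the translated cell.  Both strips
  have the same integral by periodicity.
\<close>

lemma integral_periodic_translate:
  fixes g :: "real ^ 'd::finite \<Rightarrow> real"
  assumes g: "continuous_on UNIV g"
    and per: "\<And>x. g (x + (b $ i - a $ i) *\<^sub>R axis i 1) = g x"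
    and s: "0 \<le> s" "s \<le> b $ i - a $ i"
  shows "integral (cbox a b) (\<lambda>x. g (x + s *\<^sub>R axis i 1)) = integral (cbox a b) g"
proof -
  let ?e = "axis i 1 :: real ^ 'd"
  let ?L = "b $ i - a $ i"
  let ?b = "b + s *\<^sub>R ?e"
  have "integral (cbox a ?b) g = integral (cbox a b) g + integral (cbox (a + ?L *\<^sub>R ?e) ?b) g"
    using integral_split_cart[OF g, of a i "b $ i" ?b] s by simp
  moreover have "integral (cbox a ?b) g =
      integral (cbox a (b + (s - ?L) *\<^sub>R ?e)) g + integral (cbox (a + s *\<^sub>R ?e) ?b) g"
    using integral_split_cart[OF g, of a i "a $ i + s" ?b] s by (simp add: algebra_simps)
  moreover have "integral (cbox (a + ?L *\<^sub>R ?e) ?b) g = integral (cbox a (b + (s - ?L) *\<^sub>R ?e)) g"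
  proof -
    have "integral (cbox (a + ?L *\<^sub>R ?e) ?b) g
        = integral (cbox (a + ?L *\<^sub>R ?e) ((b + (s - ?L) *\<^sub>R ?e) + ?L *\<^sub>R ?e)) g"
      by (simp add: algebra_simps)
    also have "\<dots> = integral (cbox a (b + (s - ?L) *\<^sub>R ?e)) (g \<circ> (+) (?L *\<^sub>R ?e))"
      by (rule integral_shift_cbox_plus[symmetric])
    also have "g \<circ> (+) (?L *\<^sub>R ?e) = g"
      using per by (auto simp: fun_eq_iff add.commute)
    finally show ?thesis .
  qed
  moreover have "integral (cbox (a + s *\<^sub>R ?e) ?b) g = integral (cbox a b) (\<lambda>x. g (x + s *\<^sub>R ?e))"
    using integral_shift_cbox_plus[of a b g "s *\<^sub>R ?e"] by (simp add: o_def add.commute)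
  ultimately show ?thesis by simp
qed

text \<open>
  The integral of a partial derivative over the cell does not change under translation, so it equals
  its mean over all translations by up to one period; exchanging the two integrals, the fundamental
  theorem of calculus along each line gives zero.
\<close>

lemma integral_partial_derivative_periodic:
  fixes g g' :: "real ^ 'd::finite \<Rightarrow> real"
  assumes ab: "a $ i < b $ i"
    and deriv: "\<And>x. (g has_derivative D x) (at x)" "\<And>x. D x (axis i 1) = g' x"
    and cont: "continuous_on UNIV g'"
    and per: "\<And>x. g (x + (b $ i - a $ i) *\<^sub>R axis i 1) = g x"
      "\<And>x. g' (x + (b $ i - a $ i) *\<^sub>R axis i 1) = g' x"
  shows "integral (cbox a b) g' = 0"
proof -
  let ?e = "axis i 1 :: real ^ 'd"
  let ?L = "b $ i - a $ i"
  have "?L * integral (cbox a b) g' = integral (cbox 0 ?L) (\<lambda>s. integral (cbox a b) g')"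
    using ab by simp
  also have "\<dots> = integral (cbox 0 ?L) (\<lambda>s. integral (cbox a b) (\<lambda>x. g' (x + s *\<^sub>R ?e)))"
    by (intro integral_cong integral_periodic_translate[OF cont per(2), symmetric]) auto
  also have "\<dots> = integral (cbox a b) (\<lambda>x. integral (cbox 0 ?L) (\<lambda>s. g' (x + s *\<^sub>R ?e)))"
    by (rule integral_swap_continuous)
       (auto simp: split_def intro!: continuous_intros continuous_on_compose2[OF cont])
  also have "\<dots> = integral (cbox a b) (\<lambda>x. 0)"
  proof (rule integral_cong)
    fix x
    have "((\<lambda>s. g (x + s *\<^sub>R ?e)) has_vector_derivative g' (x + s *\<^sub>R ?e)) (at s within {0..?L})" for s
    proof -
      have "((\<lambda>s. x + s *\<^sub>R ?e) has_derivative (\<lambda>r. r *\<^sub>R ?e)) (at s within {0..?L})"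
        by (auto intro!: derivative_eq_intros)
      from has_derivative_compose[OF this deriv(1)]
      have "((\<lambda>s. g (x + s *\<^sub>R ?e)) has_derivative (\<lambda>r. D (x + s *\<^sub>R ?e) (r *\<^sub>R ?e))) (at s within {0..?L})" .
      moreover have "D (x + s *\<^sub>R ?e) (r *\<^sub>R ?e) = r *\<^sub>R g' (x + s *\<^sub>R ?e)" for r
        using linear_scale[OF has_derivative_linear[OF deriv(1)]] deriv(2) by metis
      ultimately show ?thesis by (simp add: has_vector_derivative_def)
    qed
    then have "((\<lambda>s. g' (x + s *\<^sub>R ?e)) has_integral (g (x + ?L *\<^sub>R ?e) - g (x + 0 *\<^sub>R ?e))) {0..?L}"
      using ab by (intro fundamental_theorem_of_calculus) auto
    then show "integral (cbox 0 ?L) (\<lambda>s. g' (x + s *\<^sub>R ?e)) = 0"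
      using per(1)[of x] by (simp add: integral_unique)
  qed
  finally show ?thesis using ab by simp
qed

section \<open>Convergence in probability and equality of differentials\<close>

context stochastic_cell
begin

lemma tendsto_in_prob_add:
  assumes S: "tendsto_in_prob S Z" and S': "tendsto_in_prob S' Z'"
  shows "tendsto_in_prob (\<lambda>m w. S m w + S' m w) (\<lambda>w. Z w + Z' w)"
  unfolding tendsto_in_prob_def
proof (intro conjI allI impI)
  have [measurable]: "S m \<in> borel_measurable M" "S' m \<in> borel_measurable M" for m
    using S S' by (auto simp: tendsto_in_prob_def)
  have [measurable]: "Z \<in> borel_measurable M" "Z' \<in> borel_measurable M"
    using S S' by (auto simp: tendsto_in_prob_def)
  show "(\<lambda>w. S m w + S' m w) \<in> borel_measurable M" for m by measurable
  show "(\<lambda>w. Z w + Z' w) \<in> borel_measurable M" by measurable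
  fix e :: real assume e: "0 < e"
  let ?P = "\<lambda>m. measure M {w \<in> space M. e / 2 < \<bar>S m w - Z w\<bar>}"
  let ?Q = "\<lambda>m. measure M {w \<in> space M. e / 2 < \<bar>S' m w - Z' w\<bar>}"
  have "(\<lambda>m. ?P m + ?Q m) \<longlonglongrightarrow> 0 + 0"
    using S S' half_gt_zero[OF e] unfolding tendsto_in_prob_def by (intro tendsto_add) blast+
  then have lim: "(\<lambda>m. ?P m + ?Q m) \<longlonglongrightarrow> 0" by simp
  have le: "measure M {w \<in> space M. e < \<bar>S m w + S' m w - (Z w + Z' w)\<bar>} \<le> ?P m + ?Q m" for m
  proof -
    have "{w \<in> space M. e < \<bar>S m w + S' m w - (Z w + Z' w)\<bar>} \<subseteq>
        {w \<in> space M. e / 2 < \<bar>S m w - Z w\<bar>} \<union> {w \<in> space M. e / 2 < \<bar>S' m w - Z' w\<bar>}"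
      by (auto simp: abs_if field_simps split: if_splits)
    then have "measure M {w \<in> space M. e < \<bar>S m w + S' m w - (Z w + Z' w)\<bar>} \<le>
        measure M ({w \<in> space M. e / 2 < \<bar>S m w - Z w\<bar>} \<union> {w \<in> space M. e / 2 < \<bar>S' m w - Z' w\<bar>})"
      by (intro finite_measure_mono) measurable
    also have "\<dots> \<le> ?P m + ?Q m"
      by (intro measure_Un_le) measurable
    finally show ?thesis .
  qed
  show "(\<lambda>m. measure M {w \<in> space M. e < \<bar>S m w + S' m w - (Z w + Z' w)\<bar>}) \<longlonglongrightarrow> 0"
    by (rule tendsto_sandwich[OF _ _ tendsto_const lim]) (use le in auto)
qed

lemma tendsto_in_prob_AE:
  assumes [measurable]: "\<And>m. S m \<in> borel_measurable M" "Z \<in> borel_measurable M"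
    and lim: "AE w in M. (\<lambda>m. S m w) \<longlonglongrightarrow> Z w"
  shows "tendsto_in_prob S Z"
  unfolding tendsto_in_prob_def
proof (intro conjI allI impI assms(1,2))
  fix e :: real assume e: "0 < e"
  let ?A = "\<lambda>m. {w \<in> space M. e < \<bar>S m w - Z w\<bar>}"
  have "(\<lambda>m. \<integral>w. indicator (?A m) w \<partial>M) \<longlonglongrightarrow> (\<integral>w. (0::real) \<partial>M)"
  proof (rule integral_dominated_convergence[where w = "\<lambda>_. 1"])
    show "AE w in M. (\<lambda>m. indicator (?A m) w :: real) \<longlonglongrightarrow> 0"
      using lim
    proof eventually_elim
      case (elim w)
      have "\<forall>\<^sub>F m in sequentially. dist (S m w) (Z w) < e"
        using tendstoD[OF elim e] .
      then have "\<forall>\<^sub>F m in sequentially. indicator (?A m) w = (0::real)"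
        by eventually_elim (auto simp: dist_real_def)
      then show ?case by (rule tendsto_eventually)
    qed
  qed (auto simp: indicator_def)
  then show "(\<lambda>m. measure M (?A m)) \<longlonglongrightarrow> 0" by simp
qed

lemma tendsto_in_prob_scale:
  assumes S: "tendsto_in_prob S Z"
  shows "tendsto_in_prob (\<lambda>m w. c * S m w) (\<lambda>w. c * Z w)"
proof (cases "c = 0")
  case True
  then show ?thesis by (intro tendsto_in_prob_AE) auto
next
  case False
  have "{w \<in> space M. e < \<bar>c * S m w - c * Z w\<bar>} = {w \<in> space M. e / \<bar>c\<bar> < \<bar>S m w - Z w\<bar>}" for e m
    using False by (simp add: right_diff_distrib[symmetric] abs_mult pos_divide_less_eq mult.commute)
  then show ?thesis
    using S False by (auto simp: tendsto_in_prob_def intro!: borel_measurable_times)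
qed

lemma tendsto_in_prob_cong_AE:
  assumes S: "tendsto_in_prob S Z"
    and [measurable]: "\<And>m. S' m \<in> borel_measurable M" "Z' \<in> borel_measurable M"
    and eq: "\<And>m. AE w in M. S' m w = S m w" "AE w in M. Z' w = Z w"
  shows "tendsto_in_prob S' Z'"
  unfolding tendsto_in_prob_def
proof (intro conjI allI impI assms(2,3))
  have [measurable]: "S m \<in> borel_measurable M" "Z \<in> borel_measurable M" for m
    using S by (auto simp: tendsto_in_prob_def)
  fix e :: real assume e: "0 < e"
  have "measure M {w \<in> space M. e < \<bar>S' m w - Z' w\<bar>} = measure M {w \<in> space M. e < \<bar>S m w - Z w\<bar>}" for m
  proof (rule finite_measure_eq_AE)
    show "AE w in M. (w \<in> {w \<in> space M. e < \<bar>S' m w - Z' w\<bar>}) = (w \<in> {w \<in> space M. e < \<bar>S m w - Z w\<bar>})"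
      using eq(1)[of m] eq(2) by eventually_elim simp
  qed measurable
  then show "(\<lambda>m. measure M {w \<in> space M. e < \<bar>S' m w - Z' w\<bar>}) \<longlonglongrightarrow> 0"
    using S e by (simp add: tendsto_in_prob_def)
qed

lemma tendsto_in_prob_unique:
  assumes S: "tendsto_in_prob S Z" and S': "tendsto_in_prob S Z'"
  shows "AE w in M. Z w = Z' w"
proof -
  have [measurable]: "Z \<in> borel_measurable M" "Z' \<in> borel_measurable M"
    using S S' by (auto simp: tendsto_in_prob_def)
  have "tendsto_in_prob (\<lambda>m w. S m w + (-1) * S m w) (\<lambda>w. Z w + (-1) * Z' w)"
    by (intro tendsto_in_prob_add tendsto_in_prob_scale S S')
  then have null: "measure M {w \<in> space M. e < \<bar>Z w - Z' w\<bar>} = 0" if "0 < e" for e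
    using that by (auto simp: tendsto_in_prob_def abs_minus_commute LIMSEQ_const_iff)
  have "AE w in M. \<bar>Z w - Z' w\<bar> \<le> 1 / Suc n" for n
    using null[of "1 / Suc n"] by (intro AE_I'[of "{w \<in> space M. 1 / Suc n < \<bar>Z w - Z' w\<bar>}"])
      (auto simp: null_sets_def emeasure_eq_measure not_le simp del: of_nat_Suc)
  then have "AE w in M. \<forall>n. \<bar>Z w - Z' w\<bar> \<le> 1 / Suc n"
    by (simp add: AE_all_countable)
  then show ?thesis
  proof eventually_elim
    case (elim w)
    have "\<bar>Z w - Z' w\<bar> \<le> 0"
      using elim by (intro tendsto_lowerbound[OF LIMSEQ_Suc[OF lim_1_over_n]]) auto
    then show ?case by simp
  qed
qed

lemma refining_partitions_exist:
  assumes "0 \<le> t"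
  obtains p K where "refining_partitions t p K"
proof
  show "refining_partitions t (\<lambda>m k. t * k / Suc m) Suc"
    unfolding refining_partitions_def is_partition_def
  proof (intro conjI allI impI)
    fix d :: real assume d: "0 < d"
    have "(\<lambda>m. t * (1 / Suc m)) \<longlonglongrightarrow> t * 0"
      by (intro tendsto_mult tendsto_const LIMSEQ_Suc[OF lim_1_over_n])
    then have "\<forall>\<^sub>F m in sequentially. t * (1 / Suc m) < d"
      using d by (intro order_tendstoD(2)) auto
    then show "\<forall>\<^sub>F m in sequentially. \<forall>k<Suc m. t * (Suc k) / Suc m - t * k / Suc m < d"
      by eventually_elim (simp add: diff_divide_distrib[symmetric] algebra_simps)
  qed (use assms in \<open>auto intro!: divide_right_mono mult_left_mono\<close>)
qed

lemma is_partition_mono: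
  assumes p: "is_partition t p K" and "j \<le> k" "k \<le> K"
  shows "p j \<le> p k"
  using assms(2,3)
proof (induction k rule: dec_induct)
  case (step n)
  moreover have "p n \<le> p (Suc n)"
    using p step.prems by (simp add: is_partition_def)
  ultimately show ?case by simp
qed simp

lemma is_partition_mem:
  assumes p: "is_partition t p K" and "k \<le> K" "t \<in> {0..T}"
  shows "p k \<in> {0..t}" "p k \<in> {0..T}"
proof -
  have "p 0 = 0" "p K = t"
    using p by (auto simp: is_partition_def)
  then show "p k \<in> {0..t}" "p k \<in> {0..T}"
    using is_partition_mono[OF p, of 0 k] is_partition_mono[OF p, of k K] assms(2,3) by simp_all
qed

lemma continuous_semimartingale_measurable:
  assumes "continuous_semimartingale X" "t \<in> {0..T}"
  shows "X t \<in> borel_measurable M"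
proof -
  obtain L A where LA: "adapted L" "adapted A" "\<And>w. w \<in> space M \<Longrightarrow> X t w = L t w + A t w"
    using assms by (auto simp: continuous_semimartingale_def continuous_local_martingale_def)
  then have [measurable]: "L t \<in> borel_measurable M" "A t \<in> borel_measurable M"
    using assms(2) by (auto simp: adapted_def intro!: measurable_from_subalg[OF subalg])
  have "(\<lambda>w. L t w + A t w) \<in> borel_measurable M" by measurable
  also have "?this \<longleftrightarrow> ?thesis"
    by (intro measurable_cong) (simp add: LA(3))
  finally show ?thesis .
qed

lemma semimartingale_field_measurable:
  assumes "semimartingale_field X" "t \<in> {0..T}"
  shows "X t x \<in> borel_measurable M"
proof -
  have "continuous_semimartingale (\<lambda>t. foldr pd [] X t x)"
    using assms(1) unfolding semimartingale_field_def by blast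
  from continuous_semimartingale_measurable[OF this assms(2)] show ?thesis by simp
qed

lemma semimartingale_field_continuous:
  assumes "semimartingale_field X" "w \<in> space M"
  shows "continuous_on ({0..T} \<times> UNIV) (\<lambda>(t, x). X t x w)"
proof -
  have "continuous_on ({0..T} \<times> UNIV) (\<lambda>(t, x). foldr pd [] X t x w)"
    using assms unfolding semimartingale_field_def by blast
  then show ?thesis by simp
qed

lemma semimartingale_field_continuous_time:
  assumes "semimartingale_field X" "w \<in> space M"
  shows "continuous_on {0..T} (\<lambda>t. X t x w)"
proof -
  have "continuous_on {0..T} (\<lambda>t. (\<lambda>(t, x). X t x w) (t, x))"
    by (rule continuous_on_compose2[OF semimartingale_field_continuous[OF assms]])
       (auto intro!: continuous_intros)
  then show ?thesis by simp
qed

lemma semimartingale_field_continuous_space: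
  assumes "semimartingale_field X" "w \<in> space M" "t \<in> {0..T}"
  shows "continuous_on S (\<lambda>x. X t x w)"
proof -
  have "continuous_on S (\<lambda>x. (\<lambda>(t, x). X t x w) (t, x))"
    by (rule continuous_on_compose2[OF semimartingale_field_continuous[OF assms(1,2)]])
       (use assms(3) in \<open>auto intro!: continuous_intros\<close>)
  then show ?thesis by simp
qed

lemma AE_all_times:
  assumes eq: "\<And>t. t \<in> {0..T} \<Longrightarrow> AE w in M. X t w = Y t w"
    and cont: "\<And>w. w \<in> space M \<Longrightarrow> continuous_on {0..T} (\<lambda>t. X t w)"
      "\<And>w. w \<in> space M \<Longrightarrow> continuous_on {0..T} (\<lambda>t. Y t w)"
  shows "AE w in M. \<forall>t\<in>{0..T}. X t w = (Y t w :: real)"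
proof -
  obtain D where D: "countable D" "D \<subseteq> {0..T}" "{0..T} \<subseteq> closure D"
    using separable[of "{0..T}"] by blast
  then have closure: "closure D = {0..T}"
    using closure_minimal[of D "{0..T}"] by auto
  have "AE w in M. \<forall>t\<in>D. X t w = Y t w"
    using D eq by (auto simp: AE_ball_countable)
  with AE_space show ?thesis
  proof eventually_elim
    case (elim w)
    have "X t w - Y t w = 0" if "t \<in> {0..T}" for t
      by (rule continuous_constant_on_closure[of D])
         (use elim cont that in \<open>auto simp: closure intro!: continuous_on_diff\<close>)
    then show ?case by auto
  qed
qed

text \<open>
  The exceptional null set in \<open>\<doteq>\<close> depends on the position; joint continuity removes this dependence.
\<close>

lemma deq_all_positions:
  assumes eq: "f \<doteq> g" and f: "semimartingale_field f" and g: "semimartingale_field g"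
  shows "AE w in M. \<forall>t\<in>{0..T}. \<forall>x. f t x w - f 0 x w = g t x w - g 0 x w"
proof -
  obtain D :: "(real ^ 'd) set" where D: "countable D" "D \<subseteq> UNIV" "UNIV \<subseteq> closure D"
    by (rule separable)
  have "AE w in M. \<forall>x\<in>D. \<forall>t\<in>{0..T}. f t x w - f 0 x w = g t x w - g 0 x w"
    using D(1) eq by (simp add: AE_ball_countable deq_def)
  with AE_space show ?thesis
  proof eventually_elim
    case (elim w)
    have "(f t x w - f 0 x w) - (g t x w - g 0 x w) = 0" if "t \<in> {0..T}" for t x
    proof (rule continuous_constant_on_closure[of D])
      show "continuous_on (closure D) (\<lambda>x. (f t x w - f 0 x w) - (g t x w - g 0 x w))"
        using elim(1) that horizon
        by (intro continuous_on_diff semimartingale_field_continuous_space f g) auto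
    qed (use elim(2) that D(3) in auto)
    then show ?case by auto
  qed
qed

lemma deq_refl: "f \<doteq> f" by (simp add: deq_def)

lemma deq_sym:
  assumes "f \<doteq> g" shows "g \<doteq> f"
  unfolding deq_def
proof
  fix x
  show "AE w in M. \<forall>t\<in>{0..T}. g t x w - g 0 x w = f t x w - f 0 x w"
    using spec[OF assms[unfolded deq_def], of x] by eventually_elim auto
qed

lemma deq_trans [trans]:
  assumes "f \<doteq> g" "g \<doteq> k" shows "f \<doteq> k"
  unfolding deq_def
proof
  fix x
  show "AE w in M. \<forall>t\<in>{0..T}. f t x w - f 0 x w = k t x w - k 0 x w"
    using spec[OF assms(1)[unfolded deq_def], of x] spec[OF assms(2)[unfolded deq_def], of x]
    by eventually_elim auto
qed

lemma deq_cong: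
  assumes "\<And>t x w. t \<in> {0..T} \<Longrightarrow> w \<in> space M \<Longrightarrow> f t x w = g t x w"
  shows "f \<doteq> g"
  unfolding deq_def
proof (intro allI AE_I2 ballI)
  fix x w t assume "w \<in> space M" "t \<in> {0..T}"
  with assms[of t w x] assms[of 0 w x] horizon
  show "f t x w - f 0 x w = g t x w - g 0 x w" by simp
qed

lemma deq_add:
  assumes "f \<doteq> f'" "g \<doteq> g'"
  shows "(\<lambda>t x w. f t x w + g t x w) \<doteq> (\<lambda>t x w. f' t x w + g' t x w)"
  unfolding deq_def
proof
  fix x
  show "AE w in M. \<forall>t\<in>{0..T}. f t x w + g t x w - (f 0 x w + g 0 x w) = f' t x w + g' t x w - (f' 0 x w + g' 0 x w)"
    using spec[OF assms(1)[unfolded deq_def], of x] spec[OF assms(2)[unfolded deq_def], of x]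
    by eventually_elim (auto simp: algebra_simps)
qed

lemma deq_scale:
  assumes "f \<doteq> f'"
  shows "(\<lambda>t x w. c * f t x w) \<doteq> (\<lambda>t x w. c * f' t x w)"
  unfolding deq_def
proof
  fix x
  show "AE w in M. \<forall>t\<in>{0..T}. c * f t x w - c * f 0 x w = c * f' t x w - c * f' 0 x w"
    using spec[OF assms(1)[unfolded deq_def], of x]
    by eventually_elim (simp add: right_diff_distrib[symmetric])
qed

lemma deq_sum:
  assumes "finite S" "\<And>i. i \<in> S \<Longrightarrow> f i \<doteq> f' i"
  shows "(\<lambda>t x w. \<Sum>i\<in>S. f i t x w) \<doteq> (\<lambda>t x w. \<Sum>i\<in>S. f' i t x w)"
  using assms
proof (induction S rule: finite_induct)
  case (insert i S)
  then have "(\<lambda>t x w. f i t x w + (\<Sum>i\<in>S. f i t x w)) \<doteq> (\<lambda>t x w. f' i t x w + (\<Sum>i\<in>S. f' i t x w))"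
    by (intro deq_add) blast+
  then show ?case using insert(1,2) by simp
qed (simp add: deq_refl)

end

section \<open>Approximating sums of Stratonovich integrals\<close>

text \<open>The sum approximating the integral of \<open>X\<close> against \<open>\<circ>dY\<close> along the partition \<open>p\<close> with \<open>K\<close> steps.\<close>

definition strat_sum :: "'w process \<Rightarrow> 'w process \<Rightarrow> (nat \<Rightarrow> real) \<Rightarrow> nat \<Rightarrow> 'w \<Rightarrow> real" where
  "strat_sum X Y p K w =
     (\<Sum>k<K. (X (p k) w + X (p (Suc k)) w) / 2 * (Y (p (Suc k)) w - Y (p k) w))"

lemma strat_sum_add:
  "strat_sum X (\<lambda>t w. Y t w + Y' t w) p K w = strat_sum X Y p K w + strat_sum X Y' p K w"
  unfolding strat_sum_def sum.distrib[symmetric]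
  by (intro sum.cong refl) (simp add: algebra_simps add_divide_distrib)

lemma strat_sum_scale:
  "strat_sum X (\<lambda>t w. c * Y t w) p K w = c * strat_sum X Y p K w"
  unfolding strat_sum_def sum_distrib_left
  by (intro sum.cong refl) (simp add: algebra_simps add_divide_distrib)

lemma strat_sum_swap:
  assumes "is_partition t p K"
  shows "strat_sum X Y p K w + strat_sum Y X p K w = X t w * Y t w - X 0 w * Y 0 w"
proof -
  have "strat_sum X Y p K w + strat_sum Y X p K w
      = (\<Sum>k<K. X (p (Suc k)) w * Y (p (Suc k)) w - X (p k) w * Y (p k) w)"
    unfolding strat_sum_def sum.distrib[symmetric]
    by (intro sum.cong refl) (simp add: field_simps)
  also have "\<dots> = X (p K) w * Y (p K) w - X (p 0) w * Y (p 0) w"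
    by (rule sum_lessThan_telescope)
  finally show ?thesis using assms by (simp add: is_partition_def)
qed

lemma strat_sum_const_left:
  assumes "is_partition t p K"
  shows "strat_sum (\<lambda>_ _. c) Y p K w = c * Y t w - c * Y 0 w"
proof -
  have "strat_sum (\<lambda>_ _. c) Y p K w = (\<Sum>k<K. c * Y (p (Suc k)) w - c * Y (p k) w)"
    unfolding strat_sum_def by (intro sum.cong refl) (simp add: algebra_simps)
  also have "\<dots> = c * Y (p K) w - c * Y (p 0) w"
    by (rule sum_lessThan_telescope)
  finally show ?thesis using assms by (simp add: is_partition_def)
qed

context stochastic_cell
begin

lemma stratonovich_alt:
  "stratonovich X Y Z \<longleftrightarrow> (\<forall>t\<in>{0..T}. \<forall>p K. refining_partitions t p K \<longrightarrow>
     tendsto_in_prob (\<lambda>m. strat_sum X Y (p m) (K m)) (Z t))"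
  unfolding stratonovich_def strat_sum_def ..

lemma strat_sum_measurable:
  assumes p: "is_partition t p K" "t \<in> {0..T}"
    and X: "\<And>t. t \<in> {0..T} \<Longrightarrow> X t \<in> borel_measurable M"
    and Y: "\<And>t. t \<in> {0..T} \<Longrightarrow> Y t \<in> borel_measurable M"
  shows "strat_sum X Y p K \<in> borel_measurable M"
  unfolding strat_sum_def
proof (rule borel_measurable_sum)
  fix k assume "k \<in> {..<K}"
  then have mem: "p k \<in> {0..T}" "p (Suc k) \<in> {0..T}"
    using is_partition_mem[OF p(1) _ p(2)] by auto
  have [measurable]: "X (p k) \<in> borel_measurable M" "X (p (Suc k)) \<in> borel_measurable M"
    "Y (p k) \<in> borel_measurable M" "Y (p (Suc k)) \<in> borel_measurable M"
    by (intro X Y mem)+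
  show "(\<lambda>w. (X (p k) w + X (p (Suc k)) w) / 2 * (Y (p (Suc k)) w - Y (p k) w)) \<in> borel_measurable M"
    by measurable
qed

lemma strat_sum_cong:
  assumes p: "is_partition t p K" "t \<in> {0..T}"
    and X: "\<And>t. t \<in> {0..T} \<Longrightarrow> X t w = X' t w"
    and Y: "\<And>t. t \<in> {0..T} \<Longrightarrow> Y t w - Y 0 w = Y' t w - Y' 0 w"
  shows "strat_sum X Y p K w = strat_sum X' Y' p K w"
  unfolding strat_sum_def
proof (rule sum.cong[OF refl])
  fix k assume "k \<in> {..<K}"
  then have mem: "p k \<in> {0..T}" "p (Suc k) \<in> {0..T}"
    using is_partition_mem[OF p(1) _ p(2)] by auto
  have "Y (p (Suc k)) w - Y (p k) w = Y' (p (Suc k)) w - Y' (p k) w"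
    using Y[OF mem(1)] Y[OF mem(2)] by linarith
  then show "(X (p k) w + X (p (Suc k)) w) / 2 * (Y (p (Suc k)) w - Y (p k) w)
      = (X' (p k) w + X' (p (Suc k)) w) / 2 * (Y' (p (Suc k)) w - Y' (p k) w)"
    using X[OF mem(1)] X[OF mem(2)] by simp
qed

text \<open>A Stratonovich integral vanishes almost surely at time \<open>0\<close>: all sums over \<open>{0..0}\<close> are zero.\<close>

lemma stratonovich_initial:
  assumes "stratonovich X Y Z"
  shows "stratonovich X Y (\<lambda>t w. Z t w - Z 0 w)"
  unfolding stratonovich_alt
proof (intro ballI allI impI)
  fix t p K assume t: "t \<in> {0..T}" and p: "refining_partitions t p K"
  obtain q :: "nat \<Rightarrow> nat \<Rightarrow> real" and N where q: "refining_partitions 0 q N"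
    using refining_partitions_exist[of 0] by auto
  have "strat_sum X Y (q m) (N m) = (\<lambda>w. 0)" for m
  proof -
    have m: "is_partition 0 (q m) (N m)"
      using q by (simp add: refining_partitions_def)
    have "q m k = 0" if "k \<le> N m" for k
      using is_partition_mem(1)[OF m that] horizon by simp
    then show ?thesis by (simp add: strat_sum_def[abs_def])
  qed
  moreover have "tendsto_in_prob (\<lambda>m. strat_sum X Y (q m) (N m)) (Z 0)"
    using assms q horizon by (simp add: stratonovich_alt)
  ultimately have "tendsto_in_prob (\<lambda>m w. 0) (Z 0)" by simp
  moreover have "tendsto_in_prob (\<lambda>m. strat_sum X Y (p m) (K m)) (Z t)"
    using assms t p by (simp add: stratonovich_alt)
  ultimately have "tendsto_in_prob (\<lambda>m w. strat_sum X Y (p m) (K m) w + (-1) * 0) (\<lambda>w. Z t w + (-1) * Z 0 w)"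
    by (intro tendsto_in_prob_add tendsto_in_prob_scale)
  then show "tendsto_in_prob (\<lambda>m. strat_sum X Y (p m) (K m)) (\<lambda>w. Z t w - Z 0 w)"
    by simp
qed

end

section \<open>The calculus of Stratonovich differentials\<close>

text \<open>
  The semimartingale fields \<open>\<A>\<close> and the coefficients \<open>\<B>\<close> of \<open>dt\<close> are fixed; the lemmas up to
  \<open>\<B>_integrable\<close> are the clauses of the regularity assumption.
\<close>

locale lu_calculus = stochastic_cell M F T a b
  for M :: "'w measure" and F :: "real \<Rightarrow> 'w measure" and T :: real and a b :: "real ^ 'd::finite" +
  fixes \<A> \<B> :: "('d, 'w) field set"
  assumes calculus: "stratonovich_calculus \<A> \<B>"
begin

lemma \<A>_semimartingale: "X \<in> \<A> \<Longrightarrow> semimartingale_field X"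
  and \<A>_const: "(\<lambda>t x w. c) \<in> \<A>"
  and \<A>_add: "X \<in> \<A> \<Longrightarrow> Y \<in> \<A> \<Longrightarrow> (\<lambda>t x w. X t x w + Y t x w) \<in> \<A>"
  and \<A>_mult: "X \<in> \<A> \<Longrightarrow> Y \<in> \<A> \<Longrightarrow> (\<lambda>t x w. X t x w * Y t x w) \<in> \<A>"
  and \<A>_pd: "X \<in> \<A> \<Longrightarrow> pd i X \<in> \<A>"
  and \<A>_sint: "X \<in> \<A> \<Longrightarrow> Y \<in> \<A> \<Longrightarrow> sint X Y \<in> \<A>"
  and \<A>_tint: "f \<in> \<B> \<Longrightarrow> tint f \<in> \<A>"
  and \<A>_\<B>: "X \<in> \<A> \<Longrightarrow> X \<in> \<B>"
  and \<B>_add: "f \<in> \<B> \<Longrightarrow> g \<in> \<B> \<Longrightarrow> (\<lambda>t x w. f t x w + g t x w) \<in> \<B>"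
  and \<B>_mult: "X \<in> \<A> \<Longrightarrow> f \<in> \<B> \<Longrightarrow> (\<lambda>t x w. X t x w * f t x w) \<in> \<B>"
  and \<B>_pd: "f \<in> \<B> \<Longrightarrow> pd i f \<in> \<B>"
  using calculus unfolding stratonovich_calculus_def by (simp_all add: subset_iff)

lemma \<A>_inverse:
  assumes "X \<in> \<A>" "\<And>t x w. t \<in> {0..T} \<Longrightarrow> w \<in> space M \<Longrightarrow> 0 < X t x w"
  shows "(\<lambda>t x w. 1 / X t x w) \<in> \<A>"
  using calculus assms unfolding stratonovich_calculus_def by simp

lemma strat_field_sint: "X \<in> \<A> \<Longrightarrow> Y \<in> \<A> \<Longrightarrow> strat_field X Y (sint X Y)"
  and sint_sint: "X \<in> \<A> \<Longrightarrow> Y \<in> \<A> \<Longrightarrow> Z \<in> \<A> \<Longrightarrow> sint X (sint Y Z) \<doteq> sint (\<lambda>t x w. X t x w * Y t x w) Z"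
  and pd_sint: "X \<in> \<A> \<Longrightarrow> Y \<in> \<A> \<Longrightarrow>
    pd i (sint X Y) \<doteq> (\<lambda>t x w. sint (pd i X) Y t x w + sint X (pd i Y) t x w)"
  and pd_tint: "f \<in> \<B> \<Longrightarrow> pd i (tint f) \<doteq> tint (pd i f)"
  and \<B>_integrable: "f \<in> \<B> \<Longrightarrow> w \<in> space M \<Longrightarrow> set_integrable lborel {0..T} (\<lambda>t. f t x w)"
  using calculus unfolding stratonovich_calculus_def by (simp_all add: subset_iff)

lemma \<A>_scale: "X \<in> \<A> \<Longrightarrow> (\<lambda>t x w. c * X t x w) \<in> \<A>"
  by (intro \<A>_mult \<A>_const)

lemma \<A>_sum: "finite S \<Longrightarrow> (\<And>i. i \<in> S \<Longrightarrow> X i \<in> \<A>) \<Longrightarrow> (\<lambda>t x w. \<Sum>i\<in>S. X i t x w) \<in> \<A>"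
  by (induction S rule: finite_induct) (simp_all add: \<A>_const \<A>_add)

lemma \<B>_scale: "f \<in> \<B> \<Longrightarrow> (\<lambda>t x w. c * f t x w) \<in> \<B>"
  by (intro \<B>_mult \<A>_const)

lemma \<B>_sum: "finite S \<Longrightarrow> (\<And>i. i \<in> S \<Longrightarrow> f i \<in> \<B>) \<Longrightarrow> (\<lambda>t x w. \<Sum>i\<in>S. f i t x w) \<in> \<B>"
  by (induction S rule: finite_induct) (simp_all add: \<A>_\<B> \<A>_const \<B>_add)

lemma \<A>_measurable: "X \<in> \<A> \<Longrightarrow> t \<in> {0..T} \<Longrightarrow> X t x \<in> borel_measurable M"
  using semimartingale_field_measurable \<A>_semimartingale by blast

text \<open>
  \<open>sprod X Y Z\<close> is the relation \<open>dZ = X \<circ> dY\<close> between fields of the class.  It only constrains the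
  increments of \<open>Z\<close>.  Unlike the choice-based \<open>sint X Y\<close>, it can be verified on approximating sums.
\<close>

definition sprod :: "('d, 'w) field \<Rightarrow> ('d, 'w) field \<Rightarrow> ('d, 'w) field \<Rightarrow> bool" where
  "sprod X Y Z \<longleftrightarrow> X \<in> \<A> \<and> Y \<in> \<A> \<and> Z \<in> \<A> \<and>
     (\<forall>x. stratonovich (\<lambda>t. X t x) (\<lambda>t. Y t x) (\<lambda>t w. Z t x w - Z 0 x w))"

lemma sprod_field: "sprod X Y Z \<Longrightarrow> X \<in> \<A>" "sprod X Y Z \<Longrightarrow> Y \<in> \<A>" "sprod X Y Z \<Longrightarrow> Z \<in> \<A>"
  by (simp_all add: sprod_def)

lemma sprodI:
  assumes "X \<in> \<A>" "Y \<in> \<A>" "Z \<in> \<A>"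
    and "\<And>x t p K. t \<in> {0..T} \<Longrightarrow> refining_partitions t p K \<Longrightarrow>
      tendsto_in_prob (\<lambda>m. strat_sum (\<lambda>t. X t x) (\<lambda>t. Y t x) (p m) (K m)) (\<lambda>w. Z t x w - Z 0 x w)"
  shows "sprod X Y Z"
  using assms by (simp add: sprod_def stratonovich_alt)

lemma sprodD:
  assumes "sprod X Y Z" "t \<in> {0..T}" "refining_partitions t p K"
  shows "tendsto_in_prob (\<lambda>m. strat_sum (\<lambda>t. X t x) (\<lambda>t. Y t x) (p m) (K m)) (\<lambda>w. Z t x w - Z 0 x w)"
  using assms by (simp add: sprod_def stratonovich_alt)

lemma sprod_sint:
  assumes "X \<in> \<A>" "Y \<in> \<A>"
  shows "sprod X Y (sint X Y)"
  using strat_field_sint[OF assms] assms stratonovich_initial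
  unfolding sprod_def strat_field_def by (blast intro: \<A>_sint)

lemma increment_measurable:
  assumes "X \<in> \<A>" "t \<in> {0..T}"
  shows "(\<lambda>w. X t x w - X 0 x w) \<in> borel_measurable M"
  using assms horizon by (intro borel_measurable_diff \<A>_measurable) auto

lemma sprod_unique:
  assumes Z: "sprod X Y Z" and Z': "sprod X Y Z'"
  shows "Z \<doteq> Z'"
  unfolding deq_def
proof
  fix x
  have sm: "semimartingale_field Z" "semimartingale_field Z'"
    using Z Z' by (auto intro: \<A>_semimartingale sprod_field)
  show "AE w in M. \<forall>t\<in>{0..T}. Z t x w - Z 0 x w = Z' t x w - Z' 0 x w"
  proof (rule AE_all_times)
    fix t assume t: "t \<in> {0..T}"
    then obtain p K where "refining_partitions t p K"
      using refining_partitions_exist[of t] by auto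
    then show "AE w in M. Z t x w - Z 0 x w = Z' t x w - Z' 0 x w"
      using sprodD[OF Z t] sprodD[OF Z' t] tendsto_in_prob_unique by blast
  qed (intro continuous_on_diff continuous_on_const semimartingale_field_continuous_time sm; assumption)+
qed

lemma sint_deqI: "sprod X Y Z \<Longrightarrow> sint X Y \<doteq> Z"
  using sprod_unique sprod_sint sprod_field by blast

text \<open>
  Of the integrand only the values at times in \<open>{0..T}\<close> matter, and of the other two fields only the
  increments up to indistinguishability.
\<close>

lemma sprod_cong:
  assumes prod: "sprod X Y Z" and mem: "X' \<in> \<A>" "Y' \<in> \<A>" "Z' \<in> \<A>"
    and X: "\<And>t x w. t \<in> {0..T} \<Longrightarrow> w \<in> space M \<Longrightarrow> X' t x w = X t x w"
    and Y: "Y' \<doteq> Y" and Z: "Z' \<doteq> Z"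
  shows "sprod X' Y' Z'"
proof (rule sprodI[OF mem])
  fix x t p K assume t: "t \<in> {0..T}" and p: "refining_partitions t p K"
  have m: "is_partition t (p m) (K m)" for m
    using p by (simp add: refining_partitions_def)
  show "tendsto_in_prob (\<lambda>m. strat_sum (\<lambda>t. X' t x) (\<lambda>t. Y' t x) (p m) (K m)) (\<lambda>w. Z' t x w - Z' 0 x w)"
  proof (rule tendsto_in_prob_cong_AE[OF sprodD[OF prod t p, of x]])
    show "strat_sum (\<lambda>t. X' t x) (\<lambda>t. Y' t x) (p m) (K m) \<in> borel_measurable M" for m
      by (rule strat_sum_measurable[OF m t]) (use mem \<A>_measurable in auto)
    show "(\<lambda>w. Z' t x w - Z' 0 x w) \<in> borel_measurable M"
      by (rule increment_measurable[OF mem(3) t])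
    show "AE w in M. strat_sum (\<lambda>t. X' t x) (\<lambda>t. Y' t x) (p m) (K m) w
        = strat_sum (\<lambda>t. X t x) (\<lambda>t. Y t x) (p m) (K m) w" for m
      using AE_space spec[OF Y[unfolded deq_def], of x]
    proof eventually_elim
      case (elim w)
      then show ?case
        by (intro strat_sum_cong[OF m t]) (auto simp: X)
    qed
    show "AE w in M. Z' t x w - Z' 0 x w = Z t x w - Z 0 x w"
      using spec[OF Z[unfolded deq_def], of x] by eventually_elim (use t in auto)
  qed
qed

lemma sprod_add:
  assumes "sprod X Y Z" "sprod X Y' Z'"
  shows "sprod X (\<lambda>t x w. Y t x w + Y' t x w) (\<lambda>t x w. Z t x w + Z' t x w)"
proof (rule sprodI)
  fix x t p K assume t: "t \<in> {0..T}" and p: "refining_partitions t p K"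
  have "tendsto_in_prob (\<lambda>m w. strat_sum (\<lambda>t. X t x) (\<lambda>t. Y t x) (p m) (K m) w
      + strat_sum (\<lambda>t. X t x) (\<lambda>t. Y' t x) (p m) (K m) w)
      (\<lambda>w. (Z t x w - Z 0 x w) + (Z' t x w - Z' 0 x w))"
    by (intro tendsto_in_prob_add sprodD[OF assms(1)] sprodD[OF assms(2)] t p)
  then show "tendsto_in_prob (\<lambda>m. strat_sum (\<lambda>t. X t x) (\<lambda>t w. Y t x w + Y' t x w) (p m) (K m))
      (\<lambda>w. Z t x w + Z' t x w - (Z 0 x w + Z' 0 x w))"
    by (simp add: strat_sum_add[abs_def] add_diff_add)
qed (use assms in \<open>auto intro: \<A>_add dest: sprod_field\<close>)

lemma sprod_scale:
  assumes "sprod X Y Z"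
  shows "sprod X (\<lambda>t x w. c * Y t x w) (\<lambda>t x w. c * Z t x w)"
proof (rule sprodI)
  fix x t p K assume t: "t \<in> {0..T}" and p: "refining_partitions t p K"
  have "tendsto_in_prob (\<lambda>m w. c * strat_sum (\<lambda>t. X t x) (\<lambda>t. Y t x) (p m) (K m) w)
      (\<lambda>w. c * (Z t x w - Z 0 x w))"
    by (intro tendsto_in_prob_scale sprodD[OF assms(1)] t p)
  then show "tendsto_in_prob (\<lambda>m. strat_sum (\<lambda>t. X t x) (\<lambda>t w. c * Y t x w) (p m) (K m))
      (\<lambda>w. c * Z t x w - c * Z 0 x w)"
    by (simp add: strat_sum_scale[abs_def] right_diff_distrib)
qed (use assms in \<open>auto intro: \<A>_scale dest: sprod_field\<close>)

lemma sprod_const_left: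
  assumes Y: "Y \<in> \<A>"
  shows "sprod (\<lambda>t x w. c) Y (\<lambda>t x w. c * Y t x w)"
proof (rule sprodI)
  fix x t p K assume t: "t \<in> {0..T}" and p: "refining_partitions t p K"
  then have "strat_sum (\<lambda>_ _. c) (\<lambda>t. Y t x) (p m) (K m) = (\<lambda>w. c * Y t x w - c * Y 0 x w)" for m
    by (intro ext strat_sum_const_left) (simp add: refining_partitions_def)
  moreover have "(\<lambda>w. c * Y t x w - c * Y 0 x w) \<in> borel_measurable M"
    using Y t by (intro increment_measurable \<A>_scale)
  ultimately show "tendsto_in_prob (\<lambda>m. strat_sum (\<lambda>t w. c) (\<lambda>t. Y t x) (p m) (K m))
      (\<lambda>w. c * Y t x w - c * Y 0 x w)"
    by (intro tendsto_in_prob_AE) auto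
qed (use assms in \<open>auto intro: \<A>_scale \<A>_const\<close>)

lemma sprod_const_right:
  assumes X: "X \<in> \<A>"
  shows "sprod X (\<lambda>t x w. c) (\<lambda>t x w. 0)"
proof (rule sprodI)
  fix x t p K
  show "tendsto_in_prob (\<lambda>m. strat_sum (\<lambda>t. X t x) (\<lambda>t w. c) (p m) (K m)) (\<lambda>w. 0 - 0)"
    by (intro tendsto_in_prob_AE) (auto simp: strat_sum_def[abs_def])
qed (use assms in \<open>auto intro: \<A>_const\<close>)

lemma sprod_sum:
  assumes "finite S" "X \<in> \<A>" "\<And>i. i \<in> S \<Longrightarrow> sprod X (Y i) (Z i)"
  shows "sprod X (\<lambda>t x w. \<Sum>i\<in>S. Y i t x w) (\<lambda>t x w. \<Sum>i\<in>S. Z i t x w)"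
  using assms(1,3)
proof (induction S rule: finite_induct)
  case (insert i S)
  then have "sprod X (\<lambda>t x w. Y i t x w + (\<Sum>i\<in>S. Y i t x w)) (\<lambda>t x w. Z i t x w + (\<Sum>i\<in>S. Z i t x w))"
    by (intro sprod_add) blast+
  then show ?case using insert(1,2) by simp
qed (simp add: sprod_const_right assms(2))

text \<open>The two approximating sums add up to the telescoping sum of the increments of \<open>X Y\<close>.\<close>

lemma sprod_leibniz:
  assumes Z: "sprod X Y Z" and Z': "sprod Y X Z'"
  shows "(\<lambda>t x w. X t x w * Y t x w) \<doteq> (\<lambda>t x w. Z t x w + Z' t x w)"
  unfolding deq_def
proof
  fix x
  have sm: "semimartingale_field Z" "semimartingale_field Z'"
    "semimartingale_field X" "semimartingale_field Y"
    using Z Z' by (auto intro: \<A>_semimartingale sprod_field)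
  show "AE w in M. \<forall>t\<in>{0..T}. X t x w * Y t x w - X 0 x w * Y 0 x w = Z t x w + Z' t x w - (Z 0 x w + Z' 0 x w)"
  proof (rule AE_all_times)
    fix t assume t: "t \<in> {0..T}"
    then obtain p K where p: "refining_partitions t p K"
      using refining_partitions_exist[of t] by auto
    have eq: "strat_sum (\<lambda>t. X t x) (\<lambda>t. Y t x) (p m) (K m) w + strat_sum (\<lambda>t. Y t x) (\<lambda>t. X t x) (p m) (K m) w
        = X t x w * Y t x w - X 0 x w * Y 0 x w" for m w
      using p by (intro strat_sum_swap) (simp add: refining_partitions_def)
    have "tendsto_in_prob (\<lambda>m w. X t x w * Y t x w - X 0 x w * Y 0 x w)
        (\<lambda>w. (Z t x w - Z 0 x w) + (Z' t x w - Z' 0 x w))"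
      using tendsto_in_prob_add[OF sprodD[OF Z t p, of x] sprodD[OF Z' t p, of x]] unfolding eq .
    moreover have "tendsto_in_prob (\<lambda>m w. X t x w * Y t x w - X 0 x w * Y 0 x w)
        (\<lambda>w. X t x w * Y t x w - X 0 x w * Y 0 x w)"
      using increment_measurable[OF \<A>_mult t, of X Y x] Z by (intro tendsto_in_prob_AE) (auto dest: sprod_field)
    ultimately have "AE w in M. X t x w * Y t x w - X 0 x w * Y 0 x w = (Z t x w - Z 0 x w) + (Z' t x w - Z' 0 x w)"
      using tendsto_in_prob_unique by blast
    then show "AE w in M. X t x w * Y t x w - X 0 x w * Y 0 x w = Z t x w + Z' t x w - (Z 0 x w + Z' 0 x w)"
      by eventually_elim simp
  qed (intro continuous_on_diff continuous_on_mult continuous_on_add continuous_on_const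
      semimartingale_field_continuous_time sm; assumption)+
qed

lemma sprod_assoc:
  assumes "X \<in> \<A>" "Y \<in> \<A>" "Z \<in> \<A>"
  shows "sprod X (sint Y Z) (sint (\<lambda>t x w. X t x w * Y t x w) Z)"
  by (rule sprod_cong[OF sprod_sint[OF assms(1) \<A>_sint[OF assms(2,3)]]])
     (auto intro: deq_sym[OF sint_sint] deq_refl \<A>_sint \<A>_mult assms)

end

section \<open>Differentials in time and derivatives in space\<close>

context stochastic_cell
begin

lemma partition_integral:
  fixes g :: "real \<Rightarrow> real"
  assumes p: "is_partition t p K" and g: "g integrable_on {0..t}"
  shows "(\<Sum>k<K. integral {p k..p (Suc k)} g) = integral {0..t} g"
proof -
  have p0: "p 0 = 0" "p K = t" using p by (auto simp: is_partition_def)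
  have "(\<Sum>k<n. integral {p k..p (Suc k)} g) = integral {0..p n} g" if "n \<le> K" for n
    using that
  proof (induction n)
    case (Suc n)
    have le: "0 \<le> p n" "p n \<le> p (Suc n)" "p (Suc n) \<le> t"
      using is_partition_mono[OF p, of 0 n] is_partition_mono[OF p, of n "Suc n"]
        is_partition_mono[OF p, of "Suc n" K] Suc.prems p0 by simp_all
    have "g integrable_on {0..p (Suc n)}"
      using g le by (intro integrable_subinterval_real[OF g]) auto
    from Henstock_Kurzweil_Integration.integral_combine[OF le(1,2) this] show ?case
      using Suc by simp
  qed (simp add: p0)
  from this[of K] show ?thesis by (simp add: p0)
qed

text \<open>
  Against an absolutely continuous integrator the trapezoidal sums converge pathwise, because the
  continuous integrand has small oscillation on each interval of a fine partition.
\<close>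

lemma trapezoidal_sums_converge:
  fixes X f :: "real \<Rightarrow> real"
  assumes X: "continuous_on {0..T} X" and f: "set_integrable lborel {0..T} f"
    and Xf: "set_integrable lborel {0..T} (\<lambda>s. X s * f s)"
    and t: "t \<in> {0..T}" and p: "refining_partitions t p K"
  shows "(\<lambda>m. \<Sum>k<K m. (X (p m k) + X (p m (Suc k))) / 2 *
      (integral {0..p m (Suc k)} f - integral {0..p m k} f)) \<longlonglongrightarrow> integral {0..t} (\<lambda>s. X s * f s)"
proof (rule LIMSEQ_I)
  fix e :: real assume e: "0 < e"
  have int: "f integrable_on {0..T}" "(\<lambda>s. X s * f s) integrable_on {0..T}" "(\<lambda>s. \<bar>f s\<bar>) integrable_on {0..T}"
    using set_borel_integral_eq_integral(1) f Xf set_integrable_abs[OF f] by blast+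
  define C where "C = integral {0..T} (\<lambda>s. \<bar>f s\<bar>)"
  have C: "0 \<le> C" unfolding C_def by (intro integral_nonneg int) auto
  \<comment> \<open>\<open>C + 1\<close> instead of \<open>C\<close>, as \<open>C\<close> may vanish\<close>
  define e' where "e' = e / (C + 1)"
  have e': "0 < e'" using e C by (simp add: e'_def)
  have "uniformly_continuous_on {0..T} X"
    by (intro compact_uniformly_continuous X) simp
  then obtain d where d: "0 < d"
    and dX: "\<And>s r. s \<in> {0..T} \<Longrightarrow> r \<in> {0..T} \<Longrightarrow> dist s r < d \<Longrightarrow> dist (X s) (X r) < e'"
    using e' unfolding uniformly_continuous_on_def by metis
  have "\<forall>\<^sub>F m in sequentially. \<forall>k<K m. p m (Suc k) - p m k < d"
    using p d by (simp add: refining_partitions_def)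
  then obtain m0 where mesh: "\<And>m k. m0 \<le> m \<Longrightarrow> k < K m \<Longrightarrow> p m (Suc k) - p m k < d"
    unfolding eventually_sequentially by blast
  show "\<exists>m0. \<forall>m\<ge>m0. norm ((\<Sum>k<K m. (X (p m k) + X (p m (Suc k))) / 2 *
      (integral {0..p m (Suc k)} f - integral {0..p m k} f)) - integral {0..t} (\<lambda>s. X s * f s)) < e"
  proof (intro exI allI impI)
    fix m assume m: "m0 \<le> m"
    let ?p = "p m"
    let ?c = "\<lambda>k. (X (?p k) + X (?p (Suc k))) / 2"
    let ?I = "\<lambda>k. {?p k..?p (Suc k)}"
    have pm: "is_partition t ?p (K m)" using p by (simp add: refining_partitions_def)
    have step: "\<bar>?c k * (integral {0..?p (Suc k)} f - integral {0..?p k} f) - integral (?I k) (\<lambda>s. X s * f s)\<bar>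
        \<le> e' * integral (?I k) (\<lambda>s. \<bar>f s\<bar>)" if k: "k < K m" for k
    proof -
      have mem: "?p k \<in> {0..T}" "?p (Suc k) \<in> {0..T}" and le: "?p k \<le> ?p (Suc k)"
        using is_partition_mem[OF pm _ t] pm k by (auto simp: is_partition_def)
      have sub: "?I k \<subseteq> {0..T}" "{0..?p (Suc k)} \<subseteq> {0..T}" using mem by auto
      have intk: "f integrable_on ?I k" "(\<lambda>s. X s * f s) integrable_on ?I k" "(\<lambda>s. \<bar>f s\<bar>) integrable_on ?I k"
        "f integrable_on {0..?p (Suc k)}"
        using int sub by (blast intro: integrable_subinterval_real)+
      have comb: "integral {0..?p k} f + integral (?I k) f = integral {0..?p (Suc k)} f"
        using mem le by (intro Henstock_Kurzweil_Integration.integral_combine intk) auto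
      have "?c k * (integral {0..?p (Suc k)} f - integral {0..?p k} f) - integral (?I k) (\<lambda>s. X s * f s)
          = integral (?I k) (\<lambda>s. ?c k * f s) - integral (?I k) (\<lambda>s. X s * f s)"
        by (simp only: integral_mult_right comb[symmetric] add_diff_cancel_left')
      also have "\<dots> = integral (?I k) (\<lambda>s. ?c k * f s - X s * f s)"
        by (intro integral_diff[symmetric] intk integrable_on_mult_right)
      finally have eq: "?c k * (integral {0..?p (Suc k)} f - integral {0..?p k} f) - integral (?I k) (\<lambda>s. X s * f s)
          = integral (?I k) (\<lambda>s. ?c k * f s - X s * f s)" .
      have "norm (integral (?I k) (\<lambda>s. ?c k * f s - X s * f s)) \<le> integral (?I k) (\<lambda>s. e' * \<bar>f s\<bar>)"
      proof (rule integral_norm_bound_integral)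
        fix s assume s: "s \<in> ?I k"
        have "dist (?p k) s < d" "dist (?p (Suc k)) s < d"
          using s mesh[OF m k] by (auto simp: dist_real_def)
        then have "dist (X (?p k)) (X s) < e'" "dist (X (?p (Suc k))) (X s) < e'"
          using s sub mem by (auto intro: dX)
        then have "\<bar>?c k - X s\<bar> \<le> e'" by (simp add: dist_real_def field_simps abs_if split: if_splits)
        then have "\<bar>?c k - X s\<bar> * \<bar>f s\<bar> \<le> e' * \<bar>f s\<bar>" by (rule mult_right_mono) simp
        then show "norm (?c k * f s - X s * f s) \<le> e' * \<bar>f s\<bar>"
          by (simp only: left_diff_distrib[symmetric] abs_mult real_norm_def)
      qed (intro integrable_diff integrable_on_mult_right intk)+
      then show ?thesis unfolding eq by simp
    qed
    have sub: "{0..t} \<subseteq> {0..T}" using t by auto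
    have intt: "(\<lambda>s. X s * f s) integrable_on {0..t}" "(\<lambda>s. \<bar>f s\<bar>) integrable_on {0..t}"
      using int sub by (blast intro: integrable_subinterval_real)+
    have "\<bar>(\<Sum>k<K m. ?c k * (integral {0..?p (Suc k)} f - integral {0..?p k} f)) - integral {0..t} (\<lambda>s. X s * f s)\<bar>
        = \<bar>\<Sum>k<K m. ?c k * (integral {0..?p (Suc k)} f - integral {0..?p k} f) - integral (?I k) (\<lambda>s. X s * f s)\<bar>"
      by (simp add: partition_integral[OF pm intt(1), symmetric] sum_subtractf)
    also have "\<dots> \<le> (\<Sum>k<K m. e' * integral (?I k) (\<lambda>s. \<bar>f s\<bar>))"
      by (rule order_trans[OF sum_abs sum_mono]) (use step in simp)
    also have "\<dots> = e' * integral {0..t} (\<lambda>s. \<bar>f s\<bar>)"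
      by (simp add: sum_distrib_left[symmetric] partition_integral[OF pm intt(2)])
    also have "\<dots> \<le> e' * C"
      unfolding C_def using e' by (intro mult_left_mono integral_subset_le sub intt int) auto
    also have "\<dots> < e"
      using e C by (simp add: e'_def field_simps)
    finally show "norm ((\<Sum>k<K m. ?c k * (integral {0..?p (Suc k)} f - integral {0..?p k} f))
        - integral {0..t} (\<lambda>s. X s * f s)) < e" by simp
  qed
qed

end

context lu_calculus
begin

lemma \<B>_integrable_upto:
  assumes "f \<in> \<B>" "t \<in> {0..T}" "w \<in> space M"
  shows "set_integrable lborel {0..t} (\<lambda>s. f s x w)"
  by (rule set_integrable_subset[OF \<B>_integrable[OF assms(1,3)]]) (use assms(2) in auto)

lemma tint_eq_integral:
  assumes "f \<in> \<B>" "t \<in> {0..T}" "w \<in> space M"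
  shows "tint f t x w = integral {0..t} (\<lambda>s. f s x w)"
  unfolding tint_def by (rule set_borel_integral_eq_integral(2)[OF \<B>_integrable_upto[OF assms]])

lemma tint_zero:
  assumes "w \<in> space M" "f \<in> \<B>" shows "tint f 0 x w = 0"
  using tint_eq_integral[OF assms(2) _ assms(1), of 0] horizon by simp

lemma tint_cong:
  assumes "t \<in> {0..T}" "\<And>s. s \<in> {0..T} \<Longrightarrow> f s x w = g s x w"
  shows "tint f t x w = tint g t x w"
  unfolding tint_def using assms by (intro set_lebesgue_integral_cong) auto

lemma tint_add:
  assumes "f \<in> \<B>" "g \<in> \<B>" "t \<in> {0..T}" "w \<in> space M"
  shows "tint (\<lambda>t x w. f t x w + g t x w) t x w = tint f t x w + tint g t x w"
  unfolding tint_def using assms by (intro set_integral_add \<B>_integrable_upto)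

lemma tint_sum:
  assumes "finite S" "\<And>i. i \<in> S \<Longrightarrow> f i \<in> \<B>" "t \<in> {0..T}" "w \<in> space M"
  shows "tint (\<lambda>t x w. \<Sum>i\<in>S. f i t x w) t x w = (\<Sum>i\<in>S. tint (f i) t x w)"
  using assms(1,2)
proof (induction S rule: finite_induct)
  case (insert i S)
  then have "tint (\<lambda>t x w. f i t x w + (\<Sum>i\<in>S. f i t x w)) t x w = tint (f i) t x w + tint (\<lambda>t x w. \<Sum>i\<in>S. f i t x w) t x w"
    by (intro tint_add \<B>_sum assms(3,4)) auto
  then show ?case using insert by simp
qed (simp add: tint_def)

text \<open>The rule \<open>X \<circ> (f dt) = (X f) dt\<close>.\<close>

lemma sprod_tint:
  assumes X: "X \<in> \<A>" and f: "f \<in> \<B>"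
  shows "sprod X (tint f) (tint (\<lambda>t x w. X t x w * f t x w))"
proof (rule sprodI)
  have Xf: "(\<lambda>t x w. X t x w * f t x w) \<in> \<B>" by (rule \<B>_mult[OF X f])
  show mem: "X \<in> \<A>" "tint f \<in> \<A>" "tint (\<lambda>t x w. X t x w * f t x w) \<in> \<A>"
    by (intro X \<A>_tint f Xf)+
  fix x t p K assume t: "t \<in> {0..T}" and p: "refining_partitions t p K"
  have m: "is_partition t (p m) (K m)" for m
    using p by (simp add: refining_partitions_def)
  show "tendsto_in_prob (\<lambda>m. strat_sum (\<lambda>t. X t x) (\<lambda>t. tint f t x) (p m) (K m))
      (\<lambda>w. tint (\<lambda>t x w. X t x w * f t x w) t x w - tint (\<lambda>t x w. X t x w * f t x w) 0 x w)"
  proof (rule tendsto_in_prob_AE)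
    show "strat_sum (\<lambda>t. X t x) (\<lambda>t. tint f t x) (p m) (K m) \<in> borel_measurable M" for m
      by (rule strat_sum_measurable[OF m t]) (use mem \<A>_measurable in auto)
    show "(\<lambda>w. tint (\<lambda>t x w. X t x w * f t x w) t x w - tint (\<lambda>t x w. X t x w * f t x w) 0 x w)
        \<in> borel_measurable M"
      by (rule increment_measurable[OF mem(3) t])
    show "AE w in M. (\<lambda>m. strat_sum (\<lambda>t. X t x) (\<lambda>t. tint f t x) (p m) (K m) w) \<longlonglongrightarrow>
        tint (\<lambda>t x w. X t x w * f t x w) t x w - tint (\<lambda>t x w. X t x w * f t x w) 0 x w"
    proof (rule AE_I2)
      fix w assume w: "w \<in> space M"
      have "strat_sum (\<lambda>t. X t x) (\<lambda>t. tint f t x) (p m) (K m) w =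
          (\<Sum>k<K m. (X (p m k) x w + X (p m (Suc k)) x w) / 2 *
            (integral {0..p m (Suc k)} (\<lambda>s. f s x w) - integral {0..p m k} (\<lambda>s. f s x w)))" for m
        unfolding strat_sum_def
      proof (rule sum.cong[OF refl])
        fix k assume "k \<in> {..<K m}"
        then have "p m k \<in> {0..T}" "p m (Suc k) \<in> {0..T}"
          using is_partition_mem[OF m _ t] by auto
        then show "(X (p m k) x w + X (p m (Suc k)) x w) / 2 * (tint f (p m (Suc k)) x w - tint f (p m k) x w) =
          (X (p m k) x w + X (p m (Suc k)) x w) / 2 *
            (integral {0..p m (Suc k)} (\<lambda>s. f s x w) - integral {0..p m k} (\<lambda>s. f s x w))"
          by (simp only: tint_eq_integral[OF f _ w])
      qed
      then show "(\<lambda>m. strat_sum (\<lambda>t. X t x) (\<lambda>t. tint f t x) (p m) (K m) w) \<longlonglongrightarrow>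
          tint (\<lambda>t x w. X t x w * f t x w) t x w - tint (\<lambda>t x w. X t x w * f t x w) 0 x w"
        using trapezoidal_sums_converge[OF semimartingale_field_continuous_time[OF \<A>_semimartingale[OF X] w]
            \<B>_integrable[OF f w] \<B>_integrable[OF Xf w] t p]
        by (simp only: tint_eq_integral[OF Xf t w] tint_zero[OF w Xf] diff_zero)
    qed
  qed
qed

lemma \<A>_differentiable:
  assumes "X \<in> \<A>" "t \<in> {0..T}" "w \<in> space M"
  shows "(\<lambda>y. X t y w) differentiable (at x)"
proof -
  have "(\<lambda>y. foldr pd [] X t y w) differentiable (at x)"
    using \<A>_semimartingale[OF assms(1)] assms(2,3) unfolding semimartingale_field_def spatially_smooth_def by blast
  then show ?thesis by simp
qed

lemma \<A>_has_derivative: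
  assumes "X \<in> \<A>" "t \<in> {0..T}" "w \<in> space M"
  shows "((\<lambda>y. X t y w) has_derivative frechet_derivative (\<lambda>y. X t y w) (at x)) (at x)"
  using \<A>_differentiable[OF assms] by (simp add: frechet_derivative_works)

lemma pd_eqI:
  assumes "((\<lambda>y. f t y w) has_derivative D) (at x)"
  shows "pd i f t x w = D (axis i 1)"
  using frechet_derivative_at[OF assms] by (simp add: pd_def)

lemma pd_add_scale:
  assumes "X \<in> \<A>" "Y \<in> \<A>" "t \<in> {0..T}" "w \<in> space M"
  shows "pd i (\<lambda>t x w. X t x w + c * Y t x w) t x w = pd i X t x w + c * pd i Y t x w"
  unfolding pd_def[of i X] pd_def[of i Y]
  by (rule pd_eqI) (intro has_derivative_add has_derivative_mult_right \<A>_has_derivative assms)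

lemma pd_mult:
  assumes "X \<in> \<A>" "Y \<in> \<A>" "t \<in> {0..T}" "w \<in> space M"
  shows "pd i (\<lambda>t x w. X t x w * Y t x w) t x w = X t x w * pd i Y t x w + pd i X t x w * Y t x w"
  unfolding pd_def[of i X] pd_def[of i Y]
  by (rule pd_eqI) (intro has_derivative_mult \<A>_has_derivative assms)

lemma pd_const: "pd i (\<lambda>t x w. c) t x w = 0"
  by (rule pd_eqI[where D = "\<lambda>_. 0"]) simp

lemma integral_pd:
  assumes X: "X \<in> \<A>" and tw: "t \<in> {0..T}" "w \<in> space M"
  shows "integral (cbox a b) (\<lambda>x. pd i X t x w) = 0"
proof (rule integral_partial_derivative_periodic[where g = "\<lambda>x. X t x w" and i = i
      and D = "\<lambda>x. frechet_derivative (\<lambda>y. X t y w) (at x)"])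
  have per: "Y t (x + (b $ i - a $ i) *\<^sub>R axis i 1) w = Y t x w" if "Y \<in> \<A>" for Y x
    using \<A>_semimartingale[OF that] tw by (simp add: semimartingale_field_def periodic_field_def)
  show "X t (x + (b $ i - a $ i) *\<^sub>R axis i 1) w = X t x w"
    and "pd i X t (x + (b $ i - a $ i) *\<^sub>R axis i 1) w = pd i X t x w" for x
    by (intro per X \<A>_pd)+
  show "continuous_on UNIV (\<lambda>x. pd i X t x w)"
    by (intro semimartingale_field_continuous_space \<A>_semimartingale \<A>_pd X tw)
  show "((\<lambda>y. X t y w) has_derivative frechet_derivative (\<lambda>y. X t y w) (at x)) (at x)" for x
    by (rule \<A>_has_derivative[OF X tw])
qed (simp_all add: cell pd_def)

end

section \<open>Transport and dilation as Stratonovich products\<close>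

context lu_calculus
begin

text \<open>
  A primitive in time of the full infinitesimal displacement \<open>v dt + \<Upsilon>\<^sup>1\<^sup>/\<^sup>2 dW\<close>.  With it drift and noise
  need not be treated separately: transport and dilation become sums of Stratonovich products.
\<close>

definition displacement :: "real \<Rightarrow> ('d, 'w) vfield \<Rightarrow> ('d, 'w) vfield \<Rightarrow> 'd \<Rightarrow> ('d, 'w) field" where
  "displacement \<Upsilon> v W i = (\<lambda>t x w. tint (component v i) t x w + sqrt \<Upsilon> * component W i t x w)"

lemma \<A>_divg: "(\<And>i. component u i \<in> \<A>) \<Longrightarrow> divg u \<in> \<A>"
  unfolding divg_def by (intro \<A>_sum \<A>_pd) simp_all

context
  fixes v W :: "('d, 'w) vfield" and \<Upsilon> \<epsilon> :: real
  assumes v: "\<And>i. component v i \<in> \<B>" and W: "\<And>i. component W i \<in> \<A>"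
begin

lemma \<A>_displacement: "displacement \<Upsilon> v W i \<in> \<A>"
  unfolding displacement_def by (intro \<A>_add \<A>_scale \<A>_tint v W)

lemma \<B>_advection: "f \<in> \<A> \<Longrightarrow> (\<lambda>t x w. component v i t x w * pd i f t x w) \<in> \<B>"
  using \<B>_mult[OF \<A>_pd v, of f i i] by (simp add: mult.commute)

lemma \<B>_divg: "divg v \<in> \<B>"
  unfolding divg_def by (intro \<B>_sum \<B>_pd v) simp

lemma \<A>_transport: "f \<in> \<A> \<Longrightarrow> transport \<epsilon> \<Upsilon> v W f \<in> \<A>"
  unfolding transport_def
  by (intro \<A>_add \<A>_scale \<A>_tint \<B>_sum \<B>_advection \<A>_sum \<A>_sint \<A>_pd W) simp_all

lemma \<A>_dilation: "g \<in> \<A> \<Longrightarrow> dilation \<Upsilon> v W g \<in> \<A>"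
  unfolding dilation_def
  by (intro \<A>_add \<A>_scale \<A>_tint \<B>_mult \<B>_divg \<A>_sint \<A>_divg W)

lemma transport_deq:
  assumes f: "f \<in> \<A>"
  shows "transport \<epsilon> \<Upsilon> v W f \<doteq>
    (\<lambda>t x w. f t x w + \<epsilon> * (\<Sum>i\<in>UNIV. sint (pd i f) (displacement \<Upsilon> v W i) t x w))"
proof -
  have adv: "sint (pd i f) (displacement \<Upsilon> v W i) \<doteq>
      (\<lambda>t x w. tint (\<lambda>t x w. pd i f t x w * component v i t x w) t x w
        + sqrt \<Upsilon> * sint (pd i f) (component W i) t x w)" for i
    unfolding displacement_def
    by (intro sint_deqI sprod_add sprod_scale sprod_tint sprod_sint \<A>_pd f v W)
  have "transport \<epsilon> \<Upsilon> v W f \<doteq> (\<lambda>t x w. f t x w + \<epsilon> * (\<Sum>i\<in>UNIV.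
      tint (\<lambda>t x w. pd i f t x w * component v i t x w) t x w
        + sqrt \<Upsilon> * sint (pd i f) (component W i) t x w))"
  proof (rule deq_cong)
    fix t x w assume "t \<in> {0..T}" "w \<in> space M"
    then have "tint (\<lambda>t x w. \<Sum>i\<in>UNIV. component v i t x w * pd i f t x w) t x w
        = (\<Sum>i\<in>UNIV. tint (\<lambda>t x w. component v i t x w * pd i f t x w) t x w)"
      by (intro tint_sum \<B>_advection f) simp_all
    then show "transport \<epsilon> \<Upsilon> v W f t x w = f t x w + \<epsilon> * (\<Sum>i\<in>UNIV.
      tint (\<lambda>t x w. pd i f t x w * component v i t x w) t x w
        + sqrt \<Upsilon> * sint (pd i f) (component W i) t x w)"
      by (simp add: transport_def sum.distrib sum_distrib_left algebra_simps mult.commute)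
  qed
  also have "\<dots> \<doteq> (\<lambda>t x w. f t x w + \<epsilon> * (\<Sum>i\<in>UNIV. sint (pd i f) (displacement \<Upsilon> v W i) t x w))"
    by (intro deq_add deq_refl deq_scale deq_sum deq_sym[OF adv]) simp
  finally show ?thesis .
qed

lemma dilation_deq:
  assumes g: "g \<in> \<A>"
  shows "dilation \<Upsilon> v W g \<doteq>
    (\<lambda>t x w. \<Sum>i\<in>UNIV. sint g (pd i (displacement \<Upsilon> v W i)) t x w)"
proof -
  have prod: "sprod g (\<lambda>t x w. tint (divg v) t x w + sqrt \<Upsilon> * divg W t x w) (dilation \<Upsilon> v W g)"
    unfolding dilation_def
    by (intro sprod_add sprod_scale sprod_tint sprod_sint g \<B>_divg \<A>_divg W)
  have "(\<lambda>t x w. \<Sum>i\<in>UNIV. pd i (displacement \<Upsilon> v W i) t x w) \<doteq>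
      (\<lambda>t x w. tint (divg v) t x w + sqrt \<Upsilon> * divg W t x w)"
  proof -
    have "(\<lambda>t x w. \<Sum>i\<in>UNIV. pd i (displacement \<Upsilon> v W i) t x w) \<doteq>
        (\<lambda>t x w. (\<Sum>i\<in>UNIV. pd i (tint (component v i)) t x w + sqrt \<Upsilon> * pd i (component W i) t x w))"
      unfolding displacement_def
      by (intro deq_cong sum.cong refl pd_add_scale \<A>_tint v W)
    also have "\<dots> \<doteq> (\<lambda>t x w. (\<Sum>i\<in>UNIV. tint (pd i (component v i)) t x w + sqrt \<Upsilon> * pd i (component W i) t x w))"
      by (intro deq_sum deq_add deq_refl pd_tint v) simp
    also have "\<dots> \<doteq> (\<lambda>t x w. tint (divg v) t x w + sqrt \<Upsilon> * divg W t x w)"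
    proof (rule deq_cong)
      fix t x w assume "t \<in> {0..T}" "w \<in> space M"
      then have "tint (divg v) t x w = (\<Sum>i\<in>UNIV. tint (pd i (component v i)) t x w)"
        unfolding divg_def by (intro tint_sum \<B>_pd v) simp_all
      then show "(\<Sum>i\<in>UNIV. tint (pd i (component v i)) t x w + sqrt \<Upsilon> * pd i (component W i) t x w)
          = tint (divg v) t x w + sqrt \<Upsilon> * divg W t x w"
        by (simp add: divg_def sum.distrib sum_distrib_left)
    qed
    finally show ?thesis .
  qed
  then have "sprod g (\<lambda>t x w. \<Sum>i\<in>UNIV. pd i (displacement \<Upsilon> v W i) t x w) (dilation \<Upsilon> v W g)"
    by (intro sprod_cong[OF prod]) (simp_all add: deq_refl g \<A>_sum \<A>_pd \<A>_displacement \<A>_dilation)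
  moreover have "sprod g (\<lambda>t x w. \<Sum>i\<in>UNIV. pd i (displacement \<Upsilon> v W i) t x w)
      (\<lambda>t x w. \<Sum>i\<in>UNIV. sint g (pd i (displacement \<Upsilon> v W i)) t x w)"
    by (intro sprod_sum sprod_sint g \<A>_pd \<A>_displacement) simp
  ultimately show ?thesis by (rule sprod_unique)
qed

end

lemma \<A>_depth: "\<eta> \<in> \<A> \<Longrightarrow> depth \<epsilon> \<eta> \<in> \<A>"
  unfolding depth_def by (intro \<A>_add \<A>_scale \<A>_const)

lemma pd_depth:
  assumes "\<eta> \<in> \<A>" "t \<in> {0..T}" "w \<in> space M"
  shows "pd i (depth \<epsilon> \<eta>) t x w = \<epsilon> * pd i \<eta> t x w"
  unfolding depth_def using pd_add_scale[OF \<A>_const assms] by (simp add: pd_const)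

text \<open>Multiplying a vanishing differential gives a vanishing differential.\<close>

lemma sprod_zero:
  assumes prod: "sprod X Y Z" and Y: "Y \<doteq> (\<lambda>t x w. 0)"
  shows "Z \<doteq> (\<lambda>t x w. 0)"
proof -
  have "sprod X (\<lambda>t x w. 0) Z"
    by (rule sprod_cong[OF prod])
       (use sprod_field[OF prod] in \<open>auto intro: \<A>_const deq_sym[OF Y] deq_refl\<close>)
  then show ?thesis
    using sprod_const_right[OF sprod_field(1)[OF prod]] by (rule sprod_unique)
qed

lemma \<A>_dG:
  assumes u: "\<And>i. component u i \<in> \<A>" and W: "\<And>i. component W i \<in> \<A>"
    and v: "\<And>i. component (ustar \<epsilon> \<Upsilon> u us) i \<in> \<B>"
  shows "dG model \<epsilon> \<Upsilon> us W u \<in> \<A>"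
proof (cases model)
  case Serre_Green_Naghdi
  have "(\<lambda>t x w. transport \<epsilon> \<Upsilon> (ustar \<epsilon> \<Upsilon> u us) W (divg u) t x w
      + (- \<epsilon>) * dilation \<Upsilon> (ustar \<epsilon> \<Upsilon> u us) W (divg u) t x w) \<in> \<A>"
    by (intro \<A>_add \<A>_scale \<A>_transport[OF v W] \<A>_dilation[OF v W] \<A>_divg u)
  then show ?thesis using Serre_Green_Naghdi by simp
qed (simp_all add: \<A>_const \<A>_divg u)

section \<open>Conservation form of the wave models\<close>

text \<open>\<open>dh + \<epsilon> \<Sum>\<^sub>i \<partial>\<^sub>i (h \<circ> dY\<^sub>i) = 0\<close>, where \<open>Y\<close> is the displacement.\<close>

lemma mass_conservation_form:
  assumes v: "\<And>i. component v i \<in> \<B>" and W: "\<And>i. component W i \<in> \<A>" and \<eta>: "\<eta> \<in> \<A>"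
    and mass: "transport \<epsilon> \<Upsilon> v W \<eta> \<doteq> (\<lambda>t x w. - dilation \<Upsilon> v W (depth \<epsilon> \<eta>) t x w)"
  shows "(\<lambda>t x w. depth \<epsilon> \<eta> t x w
      + \<epsilon> * (\<Sum>i\<in>UNIV. pd i (sint (depth \<epsilon> \<eta>) (displacement \<Upsilon> v W i)) t x w)) \<doteq> (\<lambda>t x w. 0)"
proof -
  let ?h = "depth \<epsilon> \<eta>" and ?Y = "displacement \<Upsilon> v W"
  have h: "?h \<in> \<A>" by (rule \<A>_depth[OF \<eta>])
  have Y: "?Y i \<in> \<A>" for i by (rule \<A>_displacement[OF v W])
  have grad: "sint (pd i ?h) (?Y i) \<doteq> (\<lambda>t x w. \<epsilon> * sint (pd i \<eta>) (?Y i) t x w)" for i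
  proof -
    have "sprod (\<lambda>t x w. \<epsilon>) (sint (pd i \<eta>) (?Y i)) (sint (\<lambda>t x w. \<epsilon> * pd i \<eta> t x w) (?Y i))"
      by (intro sprod_assoc \<A>_const \<A>_pd \<eta> Y)
    moreover have "sprod (\<lambda>t x w. \<epsilon>) (sint (pd i \<eta>) (?Y i)) (\<lambda>t x w. \<epsilon> * sint (pd i \<eta>) (?Y i) t x w)"
      by (intro sprod_const_left \<A>_sint \<A>_pd \<eta> Y)
    ultimately have "sint (\<lambda>t x w. \<epsilon> * pd i \<eta> t x w) (?Y i) \<doteq> (\<lambda>t x w. \<epsilon> * sint (pd i \<eta>) (?Y i) t x w)"
      by (rule sprod_unique)
    moreover have "sprod (pd i ?h) (?Y i) (sint (\<lambda>t x w. \<epsilon> * pd i \<eta> t x w) (?Y i))"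
      by (rule sprod_cong[OF sprod_sint[of "\<lambda>t x w. \<epsilon> * pd i \<eta> t x w" "?Y i"]])
         (auto intro: deq_refl \<A>_sint \<A>_scale \<A>_pd \<eta> h Y pd_depth)
    ultimately show ?thesis using sint_deqI deq_trans by blast
  qed
  have flux: "pd i (sint ?h (?Y i)) \<doteq> (\<lambda>t x w. \<epsilon> * sint (pd i \<eta>) (?Y i) t x w + sint ?h (pd i (?Y i)) t x w)" for i
    by (rule deq_trans[OF pd_sint[OF h Y]]) (intro deq_add grad deq_refl)
  have "(\<lambda>t x w. ?h t x w + \<epsilon> * (\<Sum>i\<in>UNIV. pd i (sint ?h (?Y i)) t x w)) \<doteq>
      (\<lambda>t x w. ?h t x w + \<epsilon> * (\<Sum>i\<in>UNIV. \<epsilon> * sint (pd i \<eta>) (?Y i) t x w + sint ?h (pd i (?Y i)) t x w))"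
    by (intro deq_add deq_refl deq_scale deq_sum flux) simp
  also have "\<dots> \<doteq> (\<lambda>t x w. 1 + \<epsilon> * ((\<eta> t x w + \<epsilon> * (\<Sum>i\<in>UNIV. sint (pd i \<eta>) (?Y i) t x w))
      + (\<Sum>i\<in>UNIV. sint ?h (pd i (?Y i)) t x w)))"
    by (rule deq_cong) (simp add: depth_def sum.distrib sum_distrib_left algebra_simps)
  also have "\<dots> \<doteq> (\<lambda>t x w. 1 + \<epsilon> * (transport \<epsilon> \<Upsilon> v W \<eta> t x w + dilation \<Upsilon> v W ?h t x w))"
    by (intro deq_add deq_refl deq_scale deq_sym[OF transport_deq[OF v W \<eta>]] deq_sym[OF dilation_deq[OF v W h]])
  also have "\<dots> \<doteq> (\<lambda>t x w. 1 + \<epsilon> * (- dilation \<Upsilon> v W ?h t x w + dilation \<Upsilon> v W ?h t x w))"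
    by (intro deq_add deq_refl deq_scale mass)
  also have "\<dots> \<doteq> (\<lambda>t x w. 0)" by (simp add: deq_def)
  finally show ?thesis .
qed

text \<open>
  \<open>h\<close> times the momentum equation plus \<open>J\<close> times the mass equation, for one velocity component \<open>J\<close>.
  The dispersive term of the three models enters only through the gradient of the field \<open>Q\<close>; in
  the application \<open>Q\<close> has differential \<open>h\<^sup>3/3 \<circ> dG\<close> and \<open>\<gamma> = \<epsilon> \<beta>\<^sup>2\<close>.
\<close>

lemma momentum_conservation_form:
  assumes v: "\<And>i. component v i \<in> \<B>" and W: "\<And>i. component W i \<in> \<A>" and \<eta>: "\<eta> \<in> \<A>"
    and J: "J \<in> \<A>" and Q: "Q \<in> \<A>"
    and depth_pos: "\<And>t x w. t \<in> {0..T} \<Longrightarrow> w \<in> space M \<Longrightarrow> 0 < depth \<epsilon> \<eta> t x w"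
    and mass: "transport \<epsilon> \<Upsilon> v W \<eta> \<doteq> (\<lambda>t x w. - dilation \<Upsilon> v W (depth \<epsilon> \<eta>) t x w)"
    and momentum: "(\<lambda>t x w. transport \<epsilon> \<Upsilon> v W J t x w + tint (pd j \<eta>) t x w
      - \<gamma> * sint (\<lambda>t x w. 1 / depth \<epsilon> \<eta> t x w) (pd j Q) t x w) \<doteq> (\<lambda>t x w. 0)"
  shows "(\<lambda>t x w. depth \<epsilon> \<eta> t x w * J t x w) \<doteq>
    (\<lambda>t x w. (- \<epsilon>) * (\<Sum>i\<in>UNIV. pd i (sint J (sint (depth \<epsilon> \<eta>) (displacement \<Upsilon> v W i))) t x w)
      + ((- 1) * pd j (tint (\<lambda>t x w. \<eta> t x w + (\<epsilon> / 2) * (\<eta> t x w * \<eta> t x w))) t x w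
      + \<gamma> * pd j Q t x w))"
proof -
  let ?h = "depth \<epsilon> \<eta>" and ?Y = "displacement \<Upsilon> v W"
  let ?P = "\<lambda>t x w. \<eta> t x w + (\<epsilon> / 2) * (\<eta> t x w * \<eta> t x w)"
  let ?r = "\<lambda>t x w. 1 / ?h t x w"
  let ?hJ = "\<lambda>i t x w. ?h t x w * pd i J t x w"
  have h: "?h \<in> \<A>" by (rule \<A>_depth[OF \<eta>])
  have r: "?r \<in> \<A>" by (rule \<A>_inverse[OF h depth_pos])
  have Y: "?Y i \<in> \<A>" for i by (rule \<A>_displacement[OF v W])
  have dQ: "pd j Q \<in> \<A>" by (rule \<A>_pd[OF Q])

  \<comment> \<open>\<open>h\<close> times the momentum equation; the factor \<open>1/h\<close> of the dispersive term cancels\<close>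
  let ?E1 = "\<lambda>t x w. (sint ?h J t x w + \<epsilon> * (\<Sum>i\<in>UNIV. sint (?hJ i) (?Y i) t x w))
      + (tint (\<lambda>t x w. ?h t x w * pd j \<eta> t x w) t x w + (- \<gamma>) * pd j Q t x w)"
  have "sprod ?h (sint ?r (pd j Q)) (pd j Q)"
  proof (rule sprod_cong[OF sprod_sint[OF h \<A>_sint[OF r dQ]]])
    have "sprod (\<lambda>t x w. ?h t x w * ?r t x w) (pd j Q) (\<lambda>t x w. 1 * pd j Q t x w)"
    proof (rule sprod_cong[OF sprod_const_left[OF dQ, of 1]])
      show "?h t x w * ?r t x w = 1" if "t \<in> {0..T}" "w \<in> space M" for t x w
        using depth_pos[OF that, of x] by simp
    qed (intro deq_refl \<A>_mult \<A>_scale h r dQ)+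
    then have "sint (\<lambda>t x w. ?h t x w * ?r t x w) (pd j Q) \<doteq> pd j Q"
      using sint_deqI by simp
    then show "pd j Q \<doteq> sint ?h (sint ?r (pd j Q))"
      using deq_trans[OF sint_sint[OF h r dQ]] deq_sym by blast
  qed (auto intro: deq_refl h \<A>_sint r dQ)
  then have "sprod ?h (\<lambda>t x w. (J t x w + \<epsilon> * (\<Sum>i\<in>UNIV. sint (pd i J) (?Y i) t x w))
      + (tint (pd j \<eta>) t x w + (- \<gamma>) * sint ?r (pd j Q) t x w)) ?E1"
    by (intro sprod_add sprod_scale sprod_sum sprod_sint sprod_assoc sprod_tint h J \<A>_pd Y \<A>_\<B> \<eta>) simp_all
  moreover have "(\<lambda>t x w. (J t x w + \<epsilon> * (\<Sum>i\<in>UNIV. sint (pd i J) (?Y i) t x w))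
      + (tint (pd j \<eta>) t x w + (- \<gamma>) * sint ?r (pd j Q) t x w)) \<doteq> (\<lambda>t x w. 0)"
  proof -
    have "(\<lambda>t x w. (J t x w + \<epsilon> * (\<Sum>i\<in>UNIV. sint (pd i J) (?Y i) t x w))
        + (tint (pd j \<eta>) t x w + (- \<gamma>) * sint ?r (pd j Q) t x w)) \<doteq>
      (\<lambda>t x w. transport \<epsilon> \<Upsilon> v W J t x w + (tint (pd j \<eta>) t x w + (- \<gamma>) * sint ?r (pd j Q) t x w))"
      by (intro deq_add deq_refl deq_sym[OF transport_deq[OF v W J]])
    also have "\<dots> \<doteq> (\<lambda>t x w. 0)"
      using momentum by (simp add: algebra_simps)
    finally show ?thesis .
  qed
  ultimately have E1: "?E1 \<doteq> (\<lambda>t x w. 0)" by (rule sprod_zero)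

  \<comment> \<open>\<open>J\<close> times the mass equation\<close>
  let ?E2 = "\<lambda>t x w. sint J ?h t x w + \<epsilon> * (\<Sum>i\<in>UNIV. sint J (pd i (sint ?h (?Y i))) t x w)"
  have "sprod J (\<lambda>t x w. ?h t x w + \<epsilon> * (\<Sum>i\<in>UNIV. pd i (sint ?h (?Y i)) t x w)) ?E2"
    by (intro sprod_add sprod_scale sprod_sum sprod_sint J h \<A>_pd \<A>_sint Y) simp
  then have E2: "?E2 \<doteq> (\<lambda>t x w. 0)"
    using mass_conservation_form[OF v W \<eta> mass] by (rule sprod_zero)

  \<comment> \<open>the advective terms of the two equations are together the divergence of the flux \<open>h J \<circ> dY\<close>\<close>
  have flux: "pd i (sint J (sint ?h (?Y i))) \<doteq>
      (\<lambda>t x w. sint (?hJ i) (?Y i) t x w + sint J (pd i (sint ?h (?Y i))) t x w)" for i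
  proof (rule deq_trans[OF pd_sint[OF J \<A>_sint[OF h Y]]])
    have "sint (pd i J) (sint ?h (?Y i)) \<doteq> sint (?hJ i) (?Y i)"
      using sint_sint[OF \<A>_pd[OF J] h Y, of i i] by (simp add: mult.commute)
    then show "(\<lambda>t x w. sint (pd i J) (sint ?h (?Y i)) t x w + sint J (pd i (sint ?h (?Y i))) t x w) \<doteq>
        (\<lambda>t x w. sint (?hJ i) (?Y i) t x w + sint J (pd i (sint ?h (?Y i))) t x w)"
      by (intro deq_add deq_refl)
  qed

  \<comment> \<open>the hydrostatic pressure term is the gradient of \<open>\<eta> + \<epsilon>/2 \<eta>\<^sup>2\<close>, as \<open>h = 1 + \<epsilon> \<eta>\<close>\<close>
  have P: "?P \<in> \<A>" by (intro \<A>_add \<A>_scale \<A>_mult \<eta>)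
  have pressure: "pd j (tint ?P) \<doteq> tint (\<lambda>t x w. ?h t x w * pd j \<eta> t x w)"
  proof (rule deq_trans[OF pd_tint[OF \<A>_\<B>[OF P]]], rule deq_cong, rule tint_cong)
    fix t x w assume "w \<in> space M" "t \<in> {0..T}"
    then show "pd j ?P t x w = ?h t x w * pd j \<eta> t x w"
      by (simp only: pd_add_scale \<A>_mult \<eta> pd_mult depth_def) (simp add: field_simps)
  qed

  have "(\<lambda>t x w. ?h t x w * J t x w) \<doteq> (\<lambda>t x w. sint ?h J t x w + sint J ?h t x w)"
    by (intro sprod_leibniz sprod_sint h J)
  also have "\<dots> \<doteq> (\<lambda>t x w. (?E1 t x w + ?E2 t x w)
      + ((- \<epsilon>) * (\<Sum>i\<in>UNIV. sint (?hJ i) (?Y i) t x w + sint J (pd i (sint ?h (?Y i))) t x w)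
        + ((- 1) * tint (\<lambda>t x w. ?h t x w * pd j \<eta> t x w) t x w + \<gamma> * pd j Q t x w)))"
    by (rule deq_cong) (simp add: sum.distrib algebra_simps)
  also have "\<dots> \<doteq> (\<lambda>t x w. (0 + 0)
      + ((- \<epsilon>) * (\<Sum>i\<in>UNIV. pd i (sint J (sint ?h (?Y i))) t x w)
        + ((- 1) * pd j (tint ?P) t x w + \<gamma> * pd j Q t x w)))"
    by (intro deq_add deq_scale deq_sum deq_refl E1 E2 deq_sym[OF flux] deq_sym[OF pressure]) simp
  finally show ?thesis by simp
qed

section \<open>Integration over the cell\<close>

lemma \<A>_integrable_on_cell:
  assumes "X \<in> \<A>" "t \<in> {0..T}" "w \<in> space M"
  shows "(\<lambda>x. X t x w) integrable_on cbox a b"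
  by (intro integrable_continuous semimartingale_field_continuous_space \<A>_semimartingale assms)

lemma integral_conserved:
  assumes X: "X \<in> \<A>" and D: "D \<in> \<A>" and eq: "X \<doteq> D"
    and zero: "\<And>t w. t \<in> {0..T} \<Longrightarrow> w \<in> space M \<Longrightarrow> integral (cbox a b) (\<lambda>x. D t x w) = 0"
  shows "AE w in M. \<forall>t\<in>{0..T}. integral (cbox a b) (\<lambda>x. X t x w) = integral (cbox a b) (\<lambda>x. X 0 x w)"
  using AE_space deq_all_positions[OF eq \<A>_semimartingale[OF X] \<A>_semimartingale[OF D]]
proof eventually_elim
  case (elim w)
  show ?case
  proof
    fix t assume t: "t \<in> {0..T}"
    have t0: "0 \<in> {0..T}" using horizon by simp
    have "integral (cbox a b) (\<lambda>x. X t x w) - integral (cbox a b) (\<lambda>x. X 0 x w)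
        = integral (cbox a b) (\<lambda>x. X t x w - X 0 x w)"
      by (intro integral_diff[symmetric] \<A>_integrable_on_cell X t t0 elim(1))
    also have "\<dots> = integral (cbox a b) (\<lambda>x. D t x w - D 0 x w)"
      using elim(2) t by (intro integral_cong) blast
    also have "\<dots> = integral (cbox a b) (\<lambda>x. D t x w) - integral (cbox a b) (\<lambda>x. D 0 x w)"
      by (intro integral_diff \<A>_integrable_on_cell D t t0 elim(1))
    also have "\<dots> = 0" using zero t t0 elim(1) by simp
    finally show "integral (cbox a b) (\<lambda>x. X t x w) = integral (cbox a b) (\<lambda>x. X 0 x w)" by simp
  qed
qed

lemma momentum_component_conserved:
  assumes v: "\<And>i. component v i \<in> \<B>" and W: "\<And>i. component W i \<in> \<A>" and \<eta>: "\<eta> \<in> \<A>"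
    and J: "J \<in> \<A>" and Q: "Q \<in> \<A>"
    and depth_pos: "\<And>t x w. t \<in> {0..T} \<Longrightarrow> w \<in> space M \<Longrightarrow> 0 < depth \<epsilon> \<eta> t x w"
    and mass: "transport \<epsilon> \<Upsilon> v W \<eta> \<doteq> (\<lambda>t x w. - dilation \<Upsilon> v W (depth \<epsilon> \<eta>) t x w)"
    and momentum: "(\<lambda>t x w. transport \<epsilon> \<Upsilon> v W J t x w + tint (pd j \<eta>) t x w
      - \<gamma> * sint (\<lambda>t x w. 1 / depth \<epsilon> \<eta> t x w) (pd j Q) t x w) \<doteq> (\<lambda>t x w. 0)"
  shows "AE w in M. \<forall>t\<in>{0..T}. integral (cbox a b) (\<lambda>x. depth \<epsilon> \<eta> t x w * J t x w)
    = integral (cbox a b) (\<lambda>x. depth \<epsilon> \<eta> 0 x w * J 0 x w)"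
proof -
  let ?fl = "\<lambda>i. sint J (sint (depth \<epsilon> \<eta>) (displacement \<Upsilon> v W i))"
  let ?P = "tint (\<lambda>t x w. \<eta> t x w + (\<epsilon> / 2) * (\<eta> t x w * \<eta> t x w))"
  have fl: "?fl i \<in> \<A>" for i
    by (intro \<A>_sint J \<A>_depth \<eta> \<A>_displacement v W)
  have P: "?P \<in> \<A>"
    by (intro \<A>_tint \<A>_\<B> \<A>_add \<A>_scale \<A>_mult \<eta>)
  show ?thesis
  proof (rule integral_conserved[OF _ _ momentum_conservation_form[OF assms]])
    show "(\<lambda>t x w. depth \<epsilon> \<eta> t x w * J t x w) \<in> \<A>"
      by (intro \<A>_mult \<A>_depth \<eta> J)
    show "(\<lambda>t x w. (- \<epsilon>) * (\<Sum>i\<in>UNIV. pd i (?fl i) t x w)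
        + ((- 1) * pd j ?P t x w + \<gamma> * pd j Q t x w)) \<in> \<A>"
      by (intro \<A>_add \<A>_scale \<A>_sum \<A>_pd fl P Q) simp
    fix t w assume tw: "t \<in> {0..T}" "w \<in> space M"
    have "((\<lambda>x. pd i X t x w) has_integral 0) (cbox a b)" if "X \<in> \<A>" for i X
      using integrable_integral[OF \<A>_integrable_on_cell[OF \<A>_pd[OF that] tw]] integral_pd[OF that tw]
      by simp
    from this[OF fl] this[OF P] this[OF Q] have "((\<lambda>x. (- \<epsilon>) * (\<Sum>i\<in>UNIV. pd i (?fl i) t x w)
        + ((- 1) * pd j ?P t x w + \<gamma> * pd j Q t x w)) has_integral
        ((- \<epsilon>) * (\<Sum>i\<in>(UNIV::'d set). 0) + ((- 1) * 0 + \<gamma> * 0))) (cbox a b)"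
      by (intro has_integral_add has_integral_mult_right has_integral_sum) simp_all
    then show "integral (cbox a b) (\<lambda>x. (- \<epsilon>) * (\<Sum>i\<in>UNIV. pd i (?fl i) t x w)
        + ((- 1) * pd j ?P t x w + \<gamma> * pd j Q t x w)) = 0"
      by (simp add: integral_unique)
  qed
qed

lemma momentum_component:
  assumes \<eta>: "\<eta> \<in> \<A>" and u: "\<And>i. component u i \<in> \<A>" and tw: "t \<in> {0..T}" "w \<in> space M"
  shows "momentum \<rho> \<epsilon> \<eta> u t w $ j =
    \<rho> * integral (cbox a b) (\<lambda>x. depth \<epsilon> \<eta> t x w * component u j t x w)"
proof -
  let ?f = "\<lambda>x. depth \<epsilon> \<eta> t x w *\<^sub>R u t x w"
  have "continuous_on (cbox a b) (\<lambda>x. u t x w $ i)" for i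
    using semimartingale_field_continuous_space[OF \<A>_semimartingale[OF u[of i]] tw(2,1), of "cbox a b"]
    by (simp add: component_def)
  then have "continuous_on (cbox a b) (\<lambda>x. \<chi> i. u t x w $ i)"
    by (rule continuous_on_vec_lambda)
  then have cont: "continuous_on (cbox a b) ?f"
    by (intro continuous_on_scaleR semimartingale_field_continuous_space[OF \<A>_semimartingale[OF \<A>_depth[OF \<eta>]] tw(2,1)])
       simp
  then have "(LINT x:cbox a b|lborel. ?f x) = integral (cbox a b) ?f"
    by (intro set_borel_integral_eq_integral borel_integrable_compact[unfolded set_integrable_def[symmetric]])
       (auto simp: set_integrable_def intro!: borel_integrable_compact)
  moreover have "integral (cbox a b) ?f \<bullet> axis j 1 = integral (cbox a b) (\<lambda>x. ?f x \<bullet> axis j 1)"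
    by (rule integral_component_eq[symmetric, OF integrable_continuous[OF cont]])
  ultimately show ?thesis
    by (simp add: momentum_def component_def inner_axis)
qed

end

theorem mainTheorem2:
  fixes M :: "'w measure" and F :: "real \<Rightarrow> 'w measure" and T :: real
    and a b :: "real ^ 'd::finite"
    and B :: "nat \<Rightarrow> 'w process"
    and \<phi> :: "nat \<Rightarrow> ('d, 'w) vfield"
    and W us u :: "('d, 'w) vfield"
    and \<eta> :: "('d, 'w) field"
    and \<A> \<B> :: "('d, 'w) field set"
    and \<epsilon> \<beta> \<Upsilon> \<rho>\<^sub>0 :: real
    and model :: wave_model
  assumes dim: "CARD('d) = 1 \<or> CARD('d) = 2"
    and basis: "stochastic_cell M F T a b"
    and params: "0 < \<epsilon>" "0 < \<beta>" "0 < \<Upsilon>" "0 < \<rho>\<^sub>0"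
    and brownian: "stochastic_cell.independent_brownian_motions M F T B"
    and noise_coeff: "\<And>n i. stochastic_cell.coefficient_field M F T a b (component (\<phi> n) i)"
    and noise: "stochastic_cell.noise_primitive M T \<phi> B W"
    and noise_boundary: "stochastic_cell.vanishes_on_boundary M T a b \<phi>"
    and calculus: "stochastic_cell.stratonovich_calculus M F T a b \<A> \<B>"
    and regular: "\<eta> \<in> \<A>" "\<And>i. component u i \<in> \<A>" "\<And>i. component W i \<in> \<A>" "\<And>i. component us i \<in> \<B>"
    and depth_pos: "\<And>t x w. t \<in> {0..T} \<Longrightarrow> w \<in> space M \<Longrightarrow> 0 < depth \<epsilon> \<eta> t x w"
    and solution: "stochastic_cell.lu_solution M F T a b model \<epsilon> \<beta> \<Upsilon> us W \<eta> u"
  shows "AE w in M. \<forall>t\<in>{0..T}.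
    stochastic_cell.momentum a b \<rho>\<^sub>0 \<epsilon> \<eta> u t w = stochastic_cell.momentum a b \<rho>\<^sub>0 \<epsilon> \<eta> u 0 w"
proof -
  interpret lu_calculus M F T a b \<A> \<B>
    by (intro lu_calculus.intro lu_calculus_axioms.intro basis calculus)
  let ?v = "ustar \<epsilon> \<Upsilon> u us"
  let ?Q = "sint (\<lambda>t x w. depth \<epsilon> \<eta> t x w ^ 3 / 3) (dG model \<epsilon> \<Upsilon> us W u)"
  have v: "component ?v i \<in> \<B>" for i
  proof -
    have "component ?v i = (\<lambda>t x w. component u i t x w + (- (1 / 2 * \<Upsilon> * \<epsilon>)) * component us i t x w)"
      by (simp add: component_def ustar_def)
    then show ?thesis
      by (simp only:) (intro \<B>_add \<A>_\<B> \<B>_scale regular)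
  qed
  have h: "depth \<epsilon> \<eta> \<in> \<A>" by (rule \<A>_depth[OF regular(1)])
  have "(\<lambda>t x w. (1 / 3) * (depth \<epsilon> \<eta> t x w * (depth \<epsilon> \<eta> t x w * depth \<epsilon> \<eta> t x w))) \<in> \<A>"
    by (intro \<A>_scale \<A>_mult h)
  then have "(\<lambda>t x w. depth \<epsilon> \<eta> t x w ^ 3 / 3) \<in> \<A>"
    by (simp add: power3_eq_cube mult.assoc)
  then have Q: "?Q \<in> \<A>"
    by (intro \<A>_sint \<A>_dG regular(2,3) v)
  have mass: "transport \<epsilon> \<Upsilon> ?v W \<eta> \<doteq> (\<lambda>t x w. - dilation \<Upsilon> ?v W (depth \<epsilon> \<eta>) t x w)"
    and momentum: "(\<lambda>t x w. transport \<epsilon> \<Upsilon> ?v W (component u j) t x w + tint (pd j \<eta>) t x w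
      - \<epsilon> * \<beta>\<^sup>2 * sint (\<lambda>t x w. 1 / depth \<epsilon> \<eta> t x w) (pd j ?Q) t x w) \<doteq> (\<lambda>t x w. 0)" for j
    using solution unfolding lu_solution_def by blast+
  have "AE w in M. \<forall>t\<in>{0..T}. integral (cbox a b) (\<lambda>x. depth \<epsilon> \<eta> t x w * component u j t x w)
      = integral (cbox a b) (\<lambda>x. depth \<epsilon> \<eta> 0 x w * component u j 0 x w)" for j
    by (rule momentum_component_conserved[OF v regular(3,1,2) Q depth_pos mass momentum])
  then have "AE w in M. \<forall>j\<in>UNIV. \<forall>t\<in>{0..T}.
      integral (cbox a b) (\<lambda>x. depth \<epsilon> \<eta> t x w * component u j t x w)
      = integral (cbox a b) (\<lambda>x. depth \<epsilon> \<eta> 0 x w * component u j 0 x w)"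
    unfolding AE_finite_all[OF finite_class.finite_UNIV] by blast
  with AE_space show ?thesis
  proof eventually_elim
    case (elim w)
    show ?case
    proof
      fix t assume t: "t \<in> {0..T}"
      have t0: "0 \<in> {0..T}" using horizon by simp
      show "momentum \<rho>\<^sub>0 \<epsilon> \<eta> u t w = momentum \<rho>\<^sub>0 \<epsilon> \<eta> u 0 w"
        unfolding vec_eq_iff momentum_component[OF regular(1,2) t elim(1)]
          momentum_component[OF regular(1,2) t0 elim(1)]
        by (intro allI arg_cong[where f = "(*) \<rho>\<^sub>0"] bspec[OF bspec[OF elim(2) UNIV_I] t])
    qed
  qed
qed

end
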